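(* For every $j=1,\dots,\ell-1$ one has, as maps $F(s)\to F(s)\sqcup\{0\}$: (1) $\dot e_j^{\,*}=J_j$; and (2) $\dot\sigma_j^{\,*}=R_j$.
   Context: Fix integers $n,\ell\ge2$, $s\ge0$. $F(s)$: set of $b=c_\ell\otimes\cdots\otimes c_1$, $c_j\subseteq\{1,\dots,n\}$ (columns), $\sum|c_j|=s$; $\dot F(s)$: set of $d_1\otimes\cdots\otimes d_n$, $d_i\subseteq\{1,\dots,\ell\}$, $\sum|d_i|=s$. Duality: $b^*=d(1)\otimes\cdots\otimes d(n)$ with $d(i)=\{j: i\in c_j\}$ (a bijection $F(s)\to\dot F(s)$). For $\varphi:\dot F(s)\to\dot F(s)\sqcup\{0\}$, $\varphi^*:F(s)\to F(s)\sqcup\{0\}$ is defined by $\varphi^*(b)=(\varphi(b^* ))^*$ if $\varphi(b^* )\ne0$ and $\varphi^*(b)=0$ otherwise. Crystal structures: the word of $c_\ell\otimes\cdots\otimes c_1$ concatenates the entries of $c_\ell$ (increasing), then $c_{\ell-1}$, ..., then $c_1$; the word of $d_1\otimes\cdots\otimes d_n$ concatenates $d_1,\dots,d_n$. For $i\in\{1,\dots,n-1\}$ and $b\in F(s)$, keep the letters $i,i+1$ of the word, encode $i$ by $+$ and $i+1$ by $-$, and recursively delete adjacent factors $+-$; then $f_ib$ changes the letter $i$ corresponding to the leftmost remaining $+$ into $i+1$ (and is $0$ if there is none), and $e_ib$ changes the letter $i+1$ corresponding to the rightmost remaining $-$ into $i$ (or is $0$). This is the type $A_{n-1}$ crystal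 on $F(s)$ (tensor product of the column crystals $B(\omega_k)$, $B(\omega_k)$ being the crystal of columns of size $k$). The same rule with letters $j,j+1$, $j\in\{1,\dots,\ell-1\}$, defines the type $A_{\ell-1}$ operators $\dot e_j,\dot f_j$ on $\dot F(s)$. Let $\dot\varepsilon_j(x)=\max\{m:\dot e_j^mx\ne0\}$, $\dot\varphi_j(x)=\max\{m:\dot f_j^mx\ne0\}$, and $\dot\sigma_j(x)=\dot f_j^{k}x$ if $k=\dot\varphi_j(x)-\dot\varepsilon_j(x)\ge0$, $\dot\sigma_j(x)=\dot e_j^{-k}x$ if $k<0$ (reversal of $j$-strings). $R_j$: for $b=c_\ell\otimes\cdots\otimes c_1$, $R_j(b)$ is obtained by replacing the factor $c_{j+1}\otimes c_j$ by its image under the unique isomorphism of $A_{n-1}$-crystals $B(\omega_{|c_{j+1}|})\otimes B(\omega_{|c_j|})\to B(\omega_{|c_j|})\otimes B(\omega_{|c_{j+1}|})$ (combinatorial $R$-matrix). $J_j$ (elementary horizontal jeu de taquin slide from column $j+1$ to column $j$): put $c_{j+1}$ as a right column in rows $1,\dots,|c_{j+1}|$ and $c_j$ as a left column in rows $t+1,\dots,t+|c_j|$, where $t\ge0$ is minimal such that $t+|c_j|\ge|c_{j+1}|$ and in each row containing two cells the left entry is $\le$ the right entry (minimal skew tableau). If $t=0$, $J_j(b)=0$. Otherwise place a hole in the left column at row $t$ and perform the usual jeu de taquin slide: repeatedly move into the hole the smaller of the entry directly below it and the entry directly to its right (the one below in case of equality, or the only one present), until the hole has no neighbour below or to the right;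 the resulting left and right columns are the new $c_j$ and $c_{j+1}$ and $J_j(b)$ is the resulting element of $F(s)$. *)

theory Defs
  imports Main "HOL-Library.FuncSet"
begin

section \<open>Tensor products of columns\<close>

text \<open>
  A tensor product of columns is an indexed family of sets of positive integers that is empty
  outside its index range: \<open>c\<^sub>l \<otimes> \<dots> \<otimes> c\<^sub>1\<close> is \<open>c\<close> with \<open>c j\<close> the \<open>j\<close>-th column.
  The added element \<open>0\<close> of a crystal is \<open>None\<close>.
\<close>

type_synonym cols = "nat \<Rightarrow> nat set"

definition Fset :: "nat \<Rightarrow> nat \<Rightarrow> nat \<Rightarrow> cols set" where
  "Fset n l s = {c. (\<forall>j\<in>{1..l}. c j \<subseteq> {1..n}) \<and> (\<forall>j. j \<notin> {1..l} \<longrightarrow> c j = {})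
     \<and> (\<Sum>j=1..l. card (c j)) = s}"

definition Fdot :: "nat \<Rightarrow> nat \<Rightarrow> nat \<Rightarrow> cols set" where
  "Fdot n l s = {d. (\<forall>i\<in>{1..n}. d i \<subseteq> {1..l}) \<and> (\<forall>i. i \<notin> {1..n} \<longrightarrow> d i = {})
     \<and> (\<Sum>i=1..n. card (d i)) = s}"

text \<open>
  Since families are empty outside their index range, one formula gives the duality
  \<open>b \<mapsto> b\<^sup>*\<close> as well as its inverse.
\<close>

definition dual :: "cols \<Rightarrow> cols" where
  "dual c = (\<lambda>i. {j. i \<in> c j})"

lemma dual_dual [simp]: "dual (dual c) = c"
  by (simp add: dual_def)

lemma dual_Fset:
  assumes "c \<in> Fset n l s"
  shows "dual c \<in> Fdot n l s"
proof -
  have sub: "c j \<subseteq> {1..n}" and out: "i \<in> c j \<Longrightarrow> j \<in> {1..l}" for i j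
    using assms unfolding Fset_def by (cases "j \<in> {1..l}"; auto)+
  have row: "dual c i = {j\<in>{1..l}. i \<in> c j}" for i
    using out by (auto simp: dual_def)
  have col: "c j = {i\<in>{1..n}. i \<in> c j}" for j
    using sub by blast
  have "(\<Sum>i=1..n. card (dual c i)) = (\<Sum>i=1..n. \<Sum>j=1..l. if i \<in> c j then 1 else 0)"
    unfolding row by (simp add: sum.If_cases Int_def)
  also have "\<dots> = (\<Sum>j=1..l. \<Sum>i=1..n. if i \<in> c j then 1 else 0)"
    by (rule sum.swap)
  also have "\<dots> = (\<Sum>j=1..l. card {i\<in>{1..n}. i \<in> c j})"
    by (simp add: sum.If_cases Int_def)
  also have "\<dots> = s"
    using assms unfolding col[symmetric] by (simp add: Fset_def)
  finally have "(\<Sum>i=1..n. card (dual c i)) = s" .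
  moreover have "\<forall>i. i \<notin> {1..n} \<longrightarrow> dual c i = {}"
    using sub unfolding dual_def by blast
  ultimately show ?thesis
    unfolding Fdot_def using row by auto
qed

lemma bij_betw_dual: "bij_betw dual (Fset n l s) (Fdot n l s)"
proof (rule bij_betw_byWitness[where f' = dual])
  show "dual ` Fset n l s \<subseteq> Fdot n l s"
    using dual_Fset by blast
  have "dual d \<in> Fset n l s" if "d \<in> Fdot n l s" for d
    using dual_Fset[of d l n s] that by (simp add: Fset_def Fdot_def)
  then show "dual ` Fdot n l s \<subseteq> Fset n l s"
    by blast
qed simp_all

definition star :: "(cols \<Rightarrow> cols option) \<Rightarrow> cols \<Rightarrow> cols option" where
  "star p b = map_option dual (p (dual b))"

section \<open>Crystal operators\<close>

text \<open>
  \<open>ks\<close> lists the column indices from left to right in the tensor product.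
  Each letter of the word is tagged with the index of its column, so that a pair
  \<open>(k, a)\<close> identifies an occurrence.
\<close>

definition word :: "nat list \<Rightarrow> cols \<Rightarrow> (nat \<times> nat) list" where
  "word ks c = concat (map (\<lambda>k. map (Pair k) (sorted_list_of_set (c k))) ks)"

text \<open>
  Recursive deletion of adjacent factors \<open>+-\<close> (\<open>i\<close> is \<open>+\<close>, \<open>i + 1\<close> is \<open>-\<close>), from the right:
  the tail is already of the form \<open>-\<dots>-+\<dots>+\<close>.
\<close>

fun cancel :: "nat \<Rightarrow> (nat \<times> nat) list \<Rightarrow> (nat \<times> nat) list" where
  "cancel i [] = []"
| "cancel i (x # xs) =
     (case cancel i xs of
        [] \<Rightarrow> [x]
      | y # ys \<Rightarrow> if snd x = i \<and> snd y = i + 1 then ys else x # y # ys)"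

definition signature :: "nat list \<Rightarrow> nat \<Rightarrow> cols \<Rightarrow> (nat \<times> nat) list" where
  "signature ks i c = cancel i (filter (\<lambda>(k, a). a = i \<or> a = i + 1) (word ks c))"

definition f_op :: "nat list \<Rightarrow> nat \<Rightarrow> cols \<Rightarrow> cols option" where
  "f_op ks i c = (let ps = filter (\<lambda>(k, a). a = i) (signature ks i c) in
     if ps = [] then None
     else let k = fst (hd ps) in Some (c(k := insert (i + 1) (c k - {i}))))"

definition e_op :: "nat list \<Rightarrow> nat \<Rightarrow> cols \<Rightarrow> cols option" where
  "e_op ks i c = (let ms = filter (\<lambda>(k, a). a = i + 1) (signature ks i c) in
     if ms = [] then None
     else let k = fst (last ms) in Some (c(k := insert i (c k - {i + 1}))))"

fun iter :: "('a \<Rightarrow> 'a option) \<Rightarrow> nat \<Rightarrow> 'a \<Rightarrow> 'a option" where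
  "iter g 0 x = Some x"
| "iter g (Suc m) x = Option.bind (iter g m x) g"

definition string_len :: "('a \<Rightarrow> 'a option) \<Rightarrow> 'a \<Rightarrow> nat" where
  "string_len g x = Max {m. iter g m x \<noteq> None}"

abbreviation eps :: "nat list \<Rightarrow> nat \<Rightarrow> cols \<Rightarrow> nat" where
  "eps ks i \<equiv> string_len (e_op ks i)"

abbreviation phi :: "nat list \<Rightarrow> nat \<Rightarrow> cols \<Rightarrow> nat" where
  "phi ks i \<equiv> string_len (f_op ks i)"

text \<open>The coefficient of the fundamental weight \<open>\<omega>\<^sub>i\<close> in the weight.\<close>

definition wt :: "nat list \<Rightarrow> nat \<Rightarrow> cols \<Rightarrow> int" where
  "wt ks i c = int (count_list (map snd (word ks c)) i)
             - int (count_list (map snd (word ks c)) (i + 1))"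

text \<open>The type \<open>A\<^bsub>l-1\<^esub>\<close> operators on \<^const>\<open>Fdot\<close>; here the factors are \<open>d\<^sub>1 \<otimes> \<dots> \<otimes> d\<^sub>n\<close>.\<close>

definition f_dot :: "nat \<Rightarrow> nat \<Rightarrow> cols \<Rightarrow> cols option" where
  "f_dot n = f_op [1..<n + 1]"

definition e_dot :: "nat \<Rightarrow> nat \<Rightarrow> cols \<Rightarrow> cols option" where
  "e_dot n = e_op [1..<n + 1]"

definition sigma_dot :: "nat \<Rightarrow> nat \<Rightarrow> cols \<Rightarrow> cols option" where
  "sigma_dot n j x =
     (let p = string_len (f_dot n j) x; q = string_len (e_dot n j) x in
      if p \<ge> q then iter (f_dot n j) (p - q) x else iter (e_dot n j) (q - p) x)"

section \<open>The combinatorial R-matrix\<close>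

definition tensor2 :: "nat set \<Rightarrow> nat set \<Rightarrow> cols" where
  "tensor2 x y = (\<lambda>k. if k = 2 then x else if k = 1 then y else {})"

text \<open>\<open>B(\<omega>\<^sub>p) \<otimes> B(\<omega>\<^sub>q)\<close>, as families \<open>c\<^sub>2 \<otimes> c\<^sub>1\<close>.\<close>

definition BB :: "nat \<Rightarrow> nat \<Rightarrow> nat \<Rightarrow> cols set" where
  "BB n p q = {tensor2 x y | x y. x \<subseteq> {1..n} \<and> y \<subseteq> {1..n} \<and> card x = p \<and> card y = q}"

text \<open>
  Isomorphisms of crystals in Kashiwara's sense: the weight, \<open>\<epsilon>\<^sub>i\<close> and \<open>\<phi>\<^sub>i\<close> are preserved, and
  the operators are intertwined, \<open>0\<close> being sent to \<open>0\<close>.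
\<close>

definition crystal_iso :: "nat \<Rightarrow> cols set \<Rightarrow> cols set \<Rightarrow> (cols \<Rightarrow> cols) \<Rightarrow> bool" where
  "crystal_iso n A B \<psi> \<longleftrightarrow> bij_betw \<psi> A B \<and>
     (\<forall>x\<in>A. \<forall>i\<in>{1..n - 1}.
        wt [2, 1] i (\<psi> x) = wt [2, 1] i x
      \<and> eps [2, 1] i (\<psi> x) = eps [2, 1] i x
      \<and> phi [2, 1] i (\<psi> x) = phi [2, 1] i x
      \<and> e_op [2, 1] i (\<psi> x) = map_option \<psi> (e_op [2, 1] i x)
      \<and> f_op [2, 1] i (\<psi> x) = map_option \<psi> (f_op [2, 1] i x))"

text \<open>Extensionality makes the isomorphism unique as a HOL function.\<close>

definition R_matrix :: "nat \<Rightarrow> nat \<Rightarrow> nat \<Rightarrow> cols \<Rightarrow> cols" where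
  "R_matrix n p q =
     (THE \<psi>. \<psi> \<in> extensional (BB n p q) \<and> crystal_iso n (BB n p q) (BB n q p) \<psi>)"

definition R_op :: "nat \<Rightarrow> nat \<Rightarrow> cols \<Rightarrow> cols" where
  "R_op n j b =
     (let z = R_matrix n (card (b (j + 1))) (card (b j)) (tensor2 (b (j + 1)) (b j))
      in b(j + 1 := z 2, j := z 1))"

section \<open>Elementary jeu de taquin slides\<close>

text \<open>Entries of a tableau are indexed by (row, column), with rows numbered downwards.\<close>

type_synonym tableau = "nat \<times> nat \<Rightarrow> nat option"

definition next_cell :: "tableau \<Rightarrow> nat \<times> nat \<Rightarrow> (nat \<times> nat) option" where
  "next_cell T h = (case h of (r, c) \<Rightarrow>
     (case (T (r + 1, c), T (r, c + 1)) of
        (None, None) \<Rightarrow> None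
      | (Some x, None) \<Rightarrow> Some (r + 1, c)
      | (None, Some y) \<Rightarrow> Some (r, c + 1)
      | (Some x, Some y) \<Rightarrow> Some (if x \<le> y then (r + 1, c) else (r, c + 1))))"

partial_function (tailrec) jdt :: "tableau \<Rightarrow> nat \<times> nat \<Rightarrow> tableau" where
  "jdt T h = (case next_cell T h of
     None \<Rightarrow> T
   | Some h' \<Rightarrow> jdt (T(h := T h', h' := None)) h')"

text \<open>Left column \<open>x\<close> in rows \<open>t + 1, \<dots>, t + |x|\<close>, right column \<open>y\<close> in rows \<open>1, \<dots>, |y|\<close>.\<close>

definition skew :: "nat \<Rightarrow> nat set \<Rightarrow> nat set \<Rightarrow> tableau" where
  "skew t x y = (\<lambda>(r, c).
     if c = 1 \<and> r \<in> {t + 1..t + card x} then Some (sorted_list_of_set x ! (r - (t + 1)))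
     else if c = 2 \<and> r \<in> {1..card y} then Some (sorted_list_of_set y ! (r - 1))
     else None)"

definition min_shift :: "nat set \<Rightarrow> nat set \<Rightarrow> nat" where
  "min_shift x y = (LEAST t. t + card x \<ge> card y \<and>
     (\<forall>r u v. skew t x y (r, 1) = Some u \<longrightarrow> skew t x y (r, 2) = Some v \<longrightarrow> u \<le> v))"

definition column :: "tableau \<Rightarrow> nat \<Rightarrow> nat set" where
  "column T c = {a. \<exists>r. T (r, c) = Some a}"

definition J_op :: "nat \<Rightarrow> cols \<Rightarrow> cols option" where
  "J_op j b =
     (let t = min_shift (b j) (b (j + 1)) in
      if t = 0 then None
      else let T = jdt (skew t (b j) (b (j + 1))) (t, 1)
           in Some (b(j := column T 1, j + 1 := column T 2)))"

end

theory Submission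
  imports Defs
begin

text \<open>
  Write \<open>x = c\<^sub>j\<close>, \<open>y = c\<^bsub>j+1\<^esub>\<close> and let \<open>h k\<close> be the number of entries \<open>\<le> k\<close> of \<open>y\<close> minus
  that of \<open>x\<close>. In the dual word every element of \<open>y\<close> is a \<open>-\<close> and every element of \<open>x\<close> is a
  \<open>+\<close>, so the rightmost uncancelled \<open>-\<close> sits at the first position where \<open>h\<close> attains a positive
  maximum: the dual of \<open>e\<^sub>j\<close> moves that entry from \<open>y\<close> to \<open>x\<close>. The maximum of \<open>h\<close> is also the minimal
  shift of the two-column tableau, and the hole leaves the left column exactly at that entry;
  this gives (1).

  For (2), the operators acting on the two columns commute with the \<open>A\<^bsub>n-1\<^esub>\<close> operators, and the
  reversal of strings is an iterate whose length only depends on the column sizes. It is therefore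
  an isomorphism of \<open>A\<^bsub>n-1\<^esub>\<close>-crystals. Isomorphisms are unique because a highest weight element of
  \<open>B(\<omega>\<^sub>p) \<otimes> B(\<omega>\<^sub>q)\<close> has left factor \<open>{1..p}\<close> and is thus determined by its weight.
\<close>

section \<open>Bracketing\<close>

text \<open>Everything is read off the height function because both crystal structures act on it
  simply. The dual raising operator lowers a final segment of it by 2, beginning at the first
  maximum, whereas an operator of the other type changes a single value by 1. Commutation thus means
  following the first maximum through a change of one value. The danger is a change near that
  maximum, where the signature rule has to exclude the bad configurations. Commutation is proved for
  raising operators only. Lowering operators are their partial inverses on both sides, so the
  statements about them, and the isomorphism needed when the left tensor factor is the smaller one,
  come by inversion.\<close>

text \<open>
  Here \<open>d k = 1\<close> stands for \<open>-\<close> and \<open>d k = -1\<close> for \<open>+\<close>, in the convention of \<^const>\<open>cancel\<close>;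
  a position with \<open>d k = 0\<close> is neutral.
\<close>

fun minuses :: "('a \<Rightarrow> int) \<Rightarrow> 'a list \<Rightarrow> 'a list" where
  "minuses d [] = []"
| "minuses d (k # ks) =
     (if d k = 1 then k # minuses d ks else if d k = -1 then tl (minuses d ks) else minuses d ks)"

fun pluses :: "('a \<Rightarrow> int) \<Rightarrow> 'a list \<Rightarrow> 'a list" where
  "pluses d [] = []"
| "pluses d (k # ks) =
     (if d k = -1 \<and> minuses d ks = [] then k # pluses d ks else pluses d ks)"

text \<open>
  Under this condition a letter between \<open>us\<close> and \<open>vs\<close> is the rightmost uncancelled \<open>-\<close> if it is a
  \<open>-\<close>, and the leftmost uncancelled \<open>+\<close> if it is a \<open>+\<close>. Since the condition does not involve the
  letter itself, this makes \<open>e\<^sub>i\<close> and \<open>f\<^sub>i\<close> mutually inverse.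
\<close>

definition balanced :: "('a \<Rightarrow> int) \<Rightarrow> 'a list \<Rightarrow> 'a list \<Rightarrow> bool" where
  "balanced d us vs \<longleftrightarrow> (\<forall>u1 u2. us = u1 @ u2 \<longrightarrow> 0 \<le> sum_list (map d u2))
     \<and> (\<forall>v1 v2. vs = v1 @ v2 \<longrightarrow> sum_list (map d v1) \<le> 0)"

text \<open>With \<open>length_minuses_le\<close> this says that the number of uncancelled
  \<open>-\<close> is the largest prefix sum, the empty prefix included. Later arguments can reason
  with sums in place of the recursion.\<close>

lemma sum_prefix_le_minuses:
  assumes "range d \<subseteq> {-1, 0, 1}"
  shows "sum_list (map d v1) \<le> int (length (minuses d (v1 @ v2)))"
proof (induction v1)
  case (Cons a v1)
  have "d a \<in> {-1, 0, 1}" using assms by blast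
  with Cons show ?case by auto
qed simp

lemma length_minuses_le:
  assumes d: "range d \<subseteq> {-1, 0, 1}"
    and "\<And>v1 v2. vs = v1 @ v2 \<Longrightarrow> sum_list (map d v1) \<le> B"
  shows "int (length (minuses d vs)) \<le> B"
  using assms(2)
proof (induction vs arbitrary: B)
  case Nil
  show ?case using Nil[of "[]" "[]"] by simp
next
  case (Cons a vs)
  have *: "d a + sum_list (map d v1) \<le> B" if "vs = v1 @ v2" for v1 v2
    using Cons.prems[of "a # v1" v2] that by simp
  \<comment> \<open>A first letter \<open>a\<close> shifts every prefix sum, so the tail is treated
    with the bound \<open>B - d a\<close>; hence \<open>B\<close> varies in the induction.\<close>
  have "int (length (minuses d vs)) \<le> B - d a"
    by (rule Cons.IH) (use * in force)
  moreover have "0 \<le> B" using Cons.prems[of "[]"] by simp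
  moreover have "d a \<in> {-1, 0, 1}" using d by blast
  ultimately show ?case by auto
qed

lemma minuses_eq_Nil_iff:
  assumes "range d \<subseteq> {-1, 0, 1}"
  shows "minuses d vs = [] \<longleftrightarrow> (\<forall>v1 v2. vs = v1 @ v2 \<longrightarrow> sum_list (map d v1) \<le> 0)"
proof
  assume "minuses d vs = []"
  then show "\<forall>v1 v2. vs = v1 @ v2 \<longrightarrow> sum_list (map d v1) \<le> 0"
    using sum_prefix_le_minuses[OF assms] by (metis list.size(3) of_nat_0)
next
  assume "\<forall>v1 v2. vs = v1 @ v2 \<longrightarrow> sum_list (map d v1) \<le> 0"
  then have "int (length (minuses d vs)) \<le> 0"
    using length_minuses_le[OF assms] by blast
  then show "minuses d vs = []" by simp
qed

lemma balanced_Nil: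
  assumes "range d \<subseteq> {-1, 0, 1}"
  shows "balanced d [] vs \<longleftrightarrow> minuses d vs = []"
  by (simp add: balanced_def minuses_eq_Nil_iff[OF assms])

lemma balanced_Cons:
  "balanced d (a # us) vs \<longleftrightarrow> 0 \<le> d a + sum_list (map d us) \<and> balanced d us vs"
  unfolding balanced_def by (auto simp: Cons_eq_append_conv split: prod.splits) fastforce?

text \<open>The count carries the induction: a \<open>+\<close> in front deletes the head of the
  list of \<open>-\<close>, and the suffix condition guarantees at least two of them at that moment,
  so \<open>k\<close> itself is never deleted.\<close>

lemma balanced_minus:
  assumes d: "range d \<subseteq> {-1, 0, 1}" and "balanced d us vs" and "d k = 1"
  shows "minuses d (us @ k # vs) \<noteq> [] \<and> last (minuses d (us @ k # vs)) = k
    \<and> int (length (minuses d (us @ k # vs))) = 1 + sum_list (map d us)"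
  using assms(2)
proof (induction us)
  case Nil
  then show ?case using assms by (simp add: balanced_Nil)
next
  case (Cons a us)
  have "d a \<in> {-1, 0, 1}" using d by blast
  moreover have "0 \<le> d a + sum_list (map d us)" "balanced d us vs"
    using Cons.prems by (auto simp: balanced_Cons)
  moreover note Cons.IH[OF this(2)]
  ultimately show ?case
    by (cases "minuses d (us @ k # vs)") (auto simp: last_tl)
qed

text \<open>A \<open>+\<close> of \<open>us\<close> could displace \<open>k\<close> as the leftmost
  surviving \<open>+\<close> only if no \<open>-\<close> were left to its right. The count excludes
  this, since the suffix condition makes the sum of the letters of \<open>us\<close> behind such a
  \<open>+\<close> positive.\<close>

lemma balanced_plus:
  assumes d: "range d \<subseteq> {-1, 0, 1}" and "balanced d us vs" and "d k = -1"
  shows "pluses d (us @ k # vs) \<noteq> [] \<and> hd (pluses d (us @ k # vs)) = k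
    \<and> int (length (minuses d (us @ k # vs))) = sum_list (map d us)"
  using assms(2)
proof (induction us)
  case Nil
  then show ?case using assms by (simp add: balanced_Nil)
next
  case (Cons a us)
  have "d a \<in> {-1, 0, 1}" using d by blast
  moreover have "0 \<le> d a + sum_list (map d us)" "balanced d us vs"
    using Cons.prems by (auto simp: balanced_Cons)
  moreover note Cons.IH[OF this(2)]
  ultimately show ?case
    by (cases "minuses d (us @ k # vs)") auto
qed

lemma ex_balanced_minus:
  assumes d: "range d \<subseteq> {-1, 0, 1}" and "minuses d ks \<noteq> []"
  shows "\<exists>us k vs. ks = us @ k # vs \<and> d k = 1 \<and> balanced d us vs"
  using assms(2)
proof (induction ks)
  case (Cons a ks)
  show ?case
  proof (cases "minuses d ks = []")
    case True
    with Cons.prems have "d a = 1" by (auto split: if_splits)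
    with True show ?thesis using balanced_Nil[OF d] by blast
  next
    case False
    then obtain us k vs where *: "ks = us @ k # vs" "d k = 1" "balanced d us vs"
      using Cons.IH by blast
    have "int (length (minuses d ks)) = 1 + sum_list (map d us)"
      using balanced_minus[OF d *(3,2)] *(1) by simp
    moreover have "0 \<le> sum_list (map d us)" using *(3) by (simp add: balanced_def)
    moreover have "d a \<in> {-1, 0, 1}" using d by blast
    \<comment> \<open>If \<open>a\<close> were a \<open>+\<close> and the sum of \<open>us\<close>
      were 0, then \<open>a\<close> would cancel \<open>k\<close>, the only \<open>-\<close> left,
      against the assumption.\<close>
    ultimately have "0 \<le> d a + sum_list (map d us)"
      using Cons.prems by (cases "minuses d ks"; cases "tl (minuses d ks)") (auto split: if_splits)
    with * have "a # ks = (a # us) @ k # vs" "balanced d (a # us) vs"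
      by (auto simp: balanced_Cons)
    with *(2) show ?thesis by blast
  qed
qed simp

lemma ex_balanced_plus:
  assumes d: "range d \<subseteq> {-1, 0, 1}" and "pluses d ks \<noteq> []"
  shows "\<exists>us k vs. ks = us @ k # vs \<and> d k = -1 \<and> balanced d us vs"
  using assms(2)
proof (induction ks)
  case (Cons a ks)
  show ?case
  proof (cases "d a = -1 \<and> minuses d ks = []")
    case True
    then show ?thesis using balanced_Nil[OF d] by blast
  next
    case False
    then obtain us k vs where *: "ks = us @ k # vs" "d k = -1" "balanced d us vs"
      using Cons by (auto split: if_splits)
    have "int (length (minuses d ks)) = sum_list (map d us)"
      using balanced_plus[OF d *(3,2)] *(1) by simp
    moreover have "0 \<le> sum_list (map d us)" using *(3) by (simp add: balanced_def)
    moreover have "d a \<in> {-1, 0, 1}" using d by blast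
    ultimately have "0 \<le> d a + sum_list (map d us)"
      using False by (cases "minuses d ks") auto
    with * have "a # ks = (a # us) @ k # vs" "balanced d (a # us) vs"
      by (auto simp: balanced_Cons)
    with *(2) show ?thesis by blast
  qed
qed simp

section \<open>Signatures of column families\<close>

text \<open>Columns are read increasingly, so a column holding both letters contributes
  \<open>+-\<close> and cancels by itself. Each column therefore acts as at most one letter, and the
  list of column indices can replace the word.\<close>

definition defect :: "nat \<Rightarrow> cols \<Rightarrow> nat \<Rightarrow> int" where
  "defect i c k = of_bool (i + 1 \<in> c k) - of_bool (i \<in> c k)"

lemma range_defect: "range (defect i c) \<subseteq> {-1, 0, 1}"
  by (auto simp: defect_def of_bool_def split: if_splits)

lemma filter_column:
  fixes i :: nat
  assumes "finite A"
  shows "filter (\<lambda>a. a = i \<or> a = i + 1) (sorted_list_of_set A)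
    = (if i \<in> A then [i] else []) @ (if i + 1 \<in> A then [i + 1] else [])"
  by (rule sorted_distinct_set_unique) (use assms in \<open>auto simp: sorted_wrt_filter\<close>)

lemma signature_eq:
  assumes "\<And>k. k \<in> set ks \<Longrightarrow> finite (c k)"
  shows "signature ks i c = map (\<lambda>k. (k, i + 1)) (minuses (defect i c) ks)
    @ map (\<lambda>k. (k, i)) (pluses (defect i c) ks)"
  using assms
proof (induction ks)
  case (Cons k ks)
  let ?w = "filter (\<lambda>(k, a). a = i \<or> a = i + 1) (word ks c)"
  have "filter (\<lambda>(k, a). a = i \<or> a = i + 1) (word (k # ks) c)
    = (if i \<in> c k then [(k, i)] else []) @ (if i + 1 \<in> c k then [(k, i + 1)] else []) @ ?w"
    using filter_column[of "c k" i] Cons.prems by (simp add: word_def filter_map comp_def)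
  moreover have "cancel i ?w = map (\<lambda>k. (k, i + 1)) (minuses (defect i c) ks)
    @ map (\<lambda>k. (k, i)) (pluses (defect i c) ks)"
    using Cons by (simp add: signature_def)
  ultimately show ?case
    by (cases "minuses (defect i c) ks"; cases "pluses (defect i c) ks")
      (simp_all add: signature_def defect_def[of i c k])
qed (simp add: signature_def word_def)

text \<open>A balanced splitting exists as soon as a \<open>-\<close> survives, and every such
  splitting locates the same letter, the last surviving \<open>-\<close>. This form replaces the
  recursive cancellation in what follows.\<close>

lemma e_op_eq_Some_iff:
  assumes "\<And>k. k \<in> set ks \<Longrightarrow> finite (c k)"
  shows "e_op ks i c = Some c' \<longleftrightarrow> (\<exists>us k vs. ks = us @ k # vs \<and> defect i c k = 1
    \<and> balanced (defect i c) us vs \<and> c' = c(k := insert i (c k - {i + 1})))"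
proof -
  let ?M = "minuses (defect i c) ks"
  have e: "e_op ks i c = (if ?M = [] then None
      else Some (c(last ?M := insert i (c (last ?M) - {i + 1}))))"
    by (simp add: e_op_def signature_eq[OF assms] filter_map comp_def last_map Let_def)
  show ?thesis
  proof
    assume L: "e_op ks i c = Some c'"
    then have "?M \<noteq> []" by (auto simp: e split: if_splits)
    from ex_balanced_minus[OF range_defect this] obtain us k vs
      where *: "ks = us @ k # vs" "defect i c k = 1" "balanced (defect i c) us vs" by blast
    with balanced_minus[OF range_defect *(3,2)] L
    show "\<exists>us k vs. ks = us @ k # vs \<and> defect i c k = 1
      \<and> balanced (defect i c) us vs \<and> c' = c(k := insert i (c k - {i + 1}))"
      unfolding e by auto
  next
    assume "\<exists>us k vs. ks = us @ k # vs \<and> defect i c k = 1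
      \<and> balanced (defect i c) us vs \<and> c' = c(k := insert i (c k - {i + 1}))"
    then obtain us k vs where *: "ks = us @ k # vs" "defect i c k = 1"
      "balanced (defect i c) us vs" "c' = c(k := insert i (c k - {i + 1}))" by blast
    with balanced_minus[OF range_defect *(3,2)] show "e_op ks i c = Some c'"
      unfolding e by auto
  qed
qed

lemma f_op_eq_Some_iff:
  assumes "\<And>k. k \<in> set ks \<Longrightarrow> finite (c k)"
  shows "f_op ks i c = Some c' \<longleftrightarrow> (\<exists>us k vs. ks = us @ k # vs \<and> defect i c k = -1
    \<and> balanced (defect i c) us vs \<and> c' = c(k := insert (i + 1) (c k - {i})))"
proof -
  let ?P = "pluses (defect i c) ks"
  have f: "f_op ks i c = (if ?P = [] then None
      else Some (c(hd ?P := insert (i + 1) (c (hd ?P) - {i}))))"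
    by (simp add: f_op_def signature_eq[OF assms] filter_map comp_def hd_map Let_def)
  show ?thesis
  proof
    assume L: "f_op ks i c = Some c'"
    then have "?P \<noteq> []" by (auto simp: f split: if_splits)
    from ex_balanced_plus[OF range_defect this] obtain us k vs
      where *: "ks = us @ k # vs" "defect i c k = -1" "balanced (defect i c) us vs" by blast
    with balanced_plus[OF range_defect *(3,2)] L
    show "\<exists>us k vs. ks = us @ k # vs \<and> defect i c k = -1
      \<and> balanced (defect i c) us vs \<and> c' = c(k := insert (i + 1) (c k - {i}))"
      unfolding f by auto
  next
    assume "\<exists>us k vs. ks = us @ k # vs \<and> defect i c k = -1
      \<and> balanced (defect i c) us vs \<and> c' = c(k := insert (i + 1) (c k - {i}))"
    then obtain us k vs where *: "ks = us @ k # vs" "defect i c k = -1"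
      "balanced (defect i c) us vs" "c' = c(k := insert (i + 1) (c k - {i}))" by blast
    with balanced_plus[OF range_defect *(3,2)] show "f_op ks i c = Some c'"
      unfolding f by auto
  qed
qed

lemma balanced_cong:
  assumes "\<And>k. k \<in> set us \<union> set vs \<Longrightarrow> d k = d' k"
  shows "balanced d us vs \<longleftrightarrow> balanced d' us vs"
proof -
  have "map d u2 = map d' u2" if "us = u1 @ u2" for u1 u2 using assms that by auto
  moreover have "map d v1 = map d' v1" if "vs = v1 @ v2" for v1 v2 using assms that by auto
  ultimately show ?thesis unfolding balanced_def by metis
qed

lemma f_op_eq_Some_iff_e_op:
  assumes fin: "\<And>k. k \<in> set ks \<Longrightarrow> finite (c k)" and ks: "distinct ks"
  shows "f_op ks i c = Some c' \<longleftrightarrow>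
    (\<forall>k\<in>set ks. finite (c' k)) \<and> e_op ks i c' = Some c"
proof
  assume "f_op ks i c = Some c'"
  then obtain us k vs where *: "ks = us @ k # vs" "defect i c k = -1"
    "balanced (defect i c) us vs" "c' = c(k := insert (i + 1) (c k - {i}))"
    using f_op_eq_Some_iff[of ks c i c'] fin by blast
  \<comment> \<open>The families differ only in column \<open>k\<close>, which occurs neither in
    \<open>us\<close> nor in \<open>vs\<close> because \<open>ks\<close> is distinct.\<close>
  have "balanced (defect i c') us vs"
    using *(3) by (rule balanced_cong[THEN iffD1, rotated])
      (use * ks in \<open>auto simp: defect_def\<close>)
  moreover have "defect i c' k = 1" "c = c'(k := insert i (c' k - {i + 1}))"
    using *(2,4) by (auto simp: defect_def fun_eq_iff of_bool_def split: if_splits)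
  moreover have fin': "\<forall>k\<in>set ks. finite (c' k)" using fin *(4) by auto
  ultimately show "(\<forall>k\<in>set ks. finite (c' k)) \<and> e_op ks i c' = Some c"
    using e_op_eq_Some_iff[of ks c' i c] *(1) by blast
next
  assume R: "(\<forall>k\<in>set ks. finite (c' k)) \<and> e_op ks i c' = Some c"
  then obtain us k vs where *: "ks = us @ k # vs" "defect i c' k = 1"
    "balanced (defect i c') us vs" "c = c'(k := insert i (c' k - {i + 1}))"
    using e_op_eq_Some_iff[of ks c' i c] by blast
  have "balanced (defect i c) us vs"
    using *(3) by (rule balanced_cong[THEN iffD1, rotated])
      (use * ks in \<open>auto simp: defect_def\<close>)
  moreover have "defect i c k = -1" "c' = c(k := insert (i + 1) (c k - {i}))"
    using *(2,4) by (auto simp: defect_def fun_eq_iff of_bool_def split: if_splits)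
  ultimately show "f_op ks i c = Some c'"
    using f_op_eq_Some_iff[of ks c i c'] fin *(1) by blast
qed

section \<open>Heights\<close>

text \<open>Written as a sum so that the step from \<open>k\<close> to \<open>k + 1\<close> holds
  without finiteness. Elements of \<open>y\<close> count positively because they are the
  \<open>-\<close> of the dual word, whose \<open>defect\<close> is 1.\<close>

definition height :: "nat set \<Rightarrow> nat set \<Rightarrow> nat \<Rightarrow> int" where
  "height y x k = (\<Sum>a=1..k. of_bool (a \<in> y) - of_bool (a \<in> x))"

lemma height_0 [simp]: "height y x 0 = 0"
  by (simp add: height_def)

lemma height_Suc: "height y x (Suc k) = height y x k + (of_bool (Suc k \<in> y) - of_bool (Suc k \<in> x))"
  by (simp add: height_def)

lemma height_step:
  "1 \<le> k \<Longrightarrow> height y x k = height y x (k - 1) + (of_bool (k \<in> y) - of_bool (k \<in> x))"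
  by (cases k) (simp_all add: height_Suc)

lemma height_eq_card:
  assumes "0 \<notin> y" "0 \<notin> x"
  shows "height y x k = int (card (y \<inter> {..k})) - int (card (x \<inter> {..k}))"
proof -
  have "(\<Sum>a=1..k. of_bool (a \<in> z)) = int (card (z \<inter> {..k}))" if "0 \<notin> z" for z
  proof -
    have "z \<inter> {..k} = {1..k} \<inter> {a. a \<in> z}"
    proof (rule set_eqI)
      fix a show "a \<in> z \<inter> {..k} \<longleftrightarrow> a \<in> {1..k} \<inter> {a. a \<in> z}"
        using that by (cases a) auto
    qed
    then show ?thesis by simp
  qed
  with assms show ?thesis by (simp add: height_def sum_subtractf)
qed

text \<open>The form taken by \<^const>\<open>balanced\<close> in the word of the dual family.\<close>

definition pivot :: "nat set \<Rightarrow> nat set \<Rightarrow> nat \<Rightarrow> bool" where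
  "pivot y x m \<longleftrightarrow> 1 \<le> m \<and> (\<forall>k<m. height y x k \<le> height y x (m - 1))
     \<and> (\<forall>k>m. height y x k \<le> height y x m)"

lemma height_const:
  assumes "y \<subseteq> {1..n}" "x \<subseteq> {1..n}" "n \<le> k"
  shows "height y x k = height y x n"
  using assms(3)
proof (induction k rule: dec_induct)
  case (step k)
  then have "Suc k \<notin> y" "Suc k \<notin> x" using assms by auto
  with step show ?case by (simp add: height_Suc)
qed simp

lemma height_total:
  assumes "y \<subseteq> {1..n}" "x \<subseteq> {1..n}"
  shows "height y x n = int (card y) - int (card x)"
proof -
  have "y \<inter> {..n} = y" "x \<inter> {..n} = x" "0 \<notin> y" "0 \<notin> x" using assms by auto
  then show ?thesis by (simp add: height_eq_card)
qed

section \<open>The dual word and the height function\<close>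

text \<open>\<open>Fset\<close> without its condition on the total size; for \<open>l = 2\<close> it
  contains pairs of columns of all sizes.\<close>

definition col_fam :: "nat \<Rightarrow> nat \<Rightarrow> cols set" where
  "col_fam n l = {c. (\<forall>j. c j \<subseteq> {1..n}) \<and> (\<forall>j. j \<notin> {1..l} \<longrightarrow> c j = {})}"

lemma Fset_subset_col_fam: "Fset n l s \<subseteq> col_fam n l"
proof
  fix c assume c: "c \<in> Fset n l s"
  then have "c j \<subseteq> {1..n}" for j by (cases "j \<in> {1..l}") (auto simp: Fset_def)
  with c show "c \<in> col_fam n l" by (auto simp: Fset_def col_fam_def)
qed

lemma col_fam_subset: "b \<in> col_fam n l \<Longrightarrow> b k \<subseteq> {1..n}"
  by (simp add: col_fam_def)

lemma finite_col_fam: "b \<in> col_fam n l \<Longrightarrow> finite (b k)"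
  by (rule finite_subset[OF col_fam_subset]) auto

lemma finite_dual:
  assumes "c \<in> col_fam n l"
  shows "finite (dual c i)"
proof (rule finite_subset)
  show "dual c i \<subseteq> {1..l}" using assms unfolding col_fam_def dual_def by blast
qed simp

lemma sum_list_defect_dual:
  "a \<le> k \<Longrightarrow> sum_list (map (defect j (dual b)) [a + 1..<k + 1])
    = height (b (j + 1)) (b j) k - height (b (j + 1)) (b j) a"
  by (induction k rule: dec_induct) (simp_all add: height_Suc defect_def dual_def)

lemma upt_split: "i \<le> j \<Longrightarrow> j \<le> k \<Longrightarrow> [i..<k] = [i..<j] @ [j..<k]"
  using upt_add_eq_append[of i j "k - j"] by simp

lemma upt_eq_append_iff:
  "[a..<c] = us @ vs \<longleftrightarrow> (\<exists>b. us = [a..<b] \<and> vs = [b..<c] \<and> (a \<le> b \<and> b \<le> c \<or> c \<le> a \<and> b = a))"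
proof
  assume L: "[a..<c] = us @ vs"
  define k where "k = length us"
  have "length [a..<c] = length us + length vs" using L by simp
  then have "k \<le> c - a" by (simp add: k_def)
  moreover have "us = take k [a..<c]" "vs = drop k [a..<c]" using L by (simp_all add: k_def)
  ultimately show "\<exists>b. us = [a..<b] \<and> vs = [b..<c] \<and> (a \<le> b \<and> b \<le> c \<or> c \<le> a \<and> b = a)"
    by (cases "c \<le> a") (auto simp: take_upt drop_upt intro!: exI[of _ "a + k"])
next
  assume "\<exists>b. us = [a..<b] \<and> vs = [b..<c] \<and> (a \<le> b \<and> b \<le> c \<or> c \<le> a \<and> b = a)"
  then show "[a..<c] = us @ vs" using upt_split by auto
qed

text \<open>Sums of defects over an interval of the dual word are differences of the height h. A
  suffix left of \<open>m\<close> gives h(m - 1) - h(k), a prefix right of it gives h(k) - h(m), and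
  the step at \<open>m\<close> itself enters neither.\<close>

lemma balanced_dual_iff:
  assumes b: "b \<in> col_fam n l" and m: "m \<in> {1..n}"
  shows "balanced (defect j (dual b)) [1..<m] [m + 1..<n + 1] \<longleftrightarrow> pivot (b (j + 1)) (b j) m"
proof -
  let ?h = "height (b (j + 1)) (b j)" and ?d = "defect j (dual b)"
  have "(\<forall>u1 u2. [1..<m] = u1 @ u2 \<longrightarrow> 0 \<le> sum_list (map ?d u2)) \<longleftrightarrow> (\<forall>k<m. ?h k \<le> ?h (m - 1))"
    (is "?L1 \<longleftrightarrow> ?R1")
  proof
    assume L: ?L1
    show ?R1
    proof (intro allI impI)
      fix k assume "k < m"
      then have "[1..<m] = [1..<k + 1] @ [k + 1..<m - 1 + 1]"
        using upt_split[of 1 "k + 1" m] by simp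
      with L have "0 \<le> sum_list (map ?d [k + 1..<m - 1 + 1])" by blast
      with \<open>k < m\<close> show "?h k \<le> ?h (m - 1)" by (subst (asm) sum_list_defect_dual) auto
    qed
  next
    assume R: ?R1
    show ?L1
    proof (intro allI impI)
      fix u1 u2 assume "[1..<m] = u1 @ u2"
      then obtain k where k: "u2 = [k..<m]" "1 \<le> k" "k \<le> m"
        using m unfolding upt_eq_append_iff by auto
      then have "u2 = [k - 1 + 1..<m - 1 + 1]" by simp
      then have "sum_list (map ?d u2) = ?h (m - 1) - ?h (k - 1)"
        using k by (simp only:) (subst sum_list_defect_dual, auto)
      moreover have "?h (k - 1) \<le> ?h (m - 1)" using R k m by auto
      ultimately show "0 \<le> sum_list (map ?d u2)" by simp
    qed
  qed
  moreover have "(\<forall>v1 v2. [m + 1..<n + 1] = v1 @ v2 \<longrightarrow> sum_list (map ?d v1) \<le> 0) \<longleftrightarrow> (\<forall>k>m. ?h k \<le> ?h m)"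
    (is "?L2 \<longleftrightarrow> ?R2")
  proof
    assume L: ?L2
    have le: "?h k \<le> ?h m" if "m \<le> k" "k \<le> n" for k
    proof -
      have "[m + 1..<n + 1] = [m + 1..<k + 1] @ [k + 1..<n + 1]"
        using that upt_split[of "m + 1" "k + 1" "n + 1"] by simp
      with L have "sum_list (map ?d [m + 1..<k + 1]) \<le> 0" by blast
      with that show ?thesis by (subst (asm) sum_list_defect_dual) auto
    qed
    have sub: "b (j + 1) \<subseteq> {1..n}" "b j \<subseteq> {1..n}" using b by (auto simp: col_fam_def)
    show ?R2
    proof (intro allI impI)
      fix k assume "m < k"
      \<comment> \<open>Beyond \<open>n\<close> the height no longer changes, so its value at
        \<open>n\<close> takes care of all larger \<open>k\<close>.\<close>
      then show "?h k \<le> ?h m"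
        using le[of k] le[of n] height_const[OF sub, of k] m by (cases "k \<le> n") auto
    qed
  next
    assume R: ?R2
    show ?L2
    proof (intro allI impI)
      fix v1 v2 assume "[m + 1..<n + 1] = v1 @ v2"
      then obtain k where k: "v1 = [m + 1..<k]" "m + 1 \<le> k"
        using m unfolding upt_eq_append_iff by auto
      then have "v1 = [m + 1..<k - 1 + 1]" by simp
      then have "sum_list (map ?d v1) = ?h (k - 1) - ?h m"
        using k by (simp only:) (subst sum_list_defect_dual, auto)
      moreover have "?h (k - 1) \<le> ?h m" using R k by (cases "k - 1 = m") auto
      ultimately show "sum_list (map ?d v1) \<le> 0" by simp
    qed
  qed
  ultimately show ?thesis using m by (simp add: balanced_def pivot_def)
qed

lemma star_eq_Some_iff: "star g b = Some b' \<longleftrightarrow> g (dual b) = Some (dual b')"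
proof
  assume "star g b = Some b'"
  then show "g (dual b) = Some (dual b')" by (auto simp: star_def)
qed (simp add: star_def)

lemma split_upt_iff:
  "[1..<n + 1] = us @ m # vs \<longleftrightarrow> m \<in> {1..n} \<and> us = [1..<m] \<and> vs = [m + 1..<n + 1]"
proof
  assume "[1..<n + 1] = us @ m # vs"
  then obtain b where b: "us = [1..<b]" "m # vs = [b..<n + 1]" "1 \<le> b"
    unfolding upt_eq_append_iff by blast
  then show "m \<in> {1..n} \<and> us = [1..<m] \<and> vs = [m + 1..<n + 1]"
    unfolding eq_commute[of "m # vs"] upt_eq_Cons_conv by auto
next
  assume "m \<in> {1..n} \<and> us = [1..<m] \<and> vs = [m + 1..<n + 1]"
  then show "[1..<n + 1] = us @ m # vs"
    using upt_split[of 1 m "n + 1"] upt_conv_Cons[of m "n + 1"] by simp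
qed

text \<open>Replacing the letter \<open>j + 1\<close> of the \<open>m\<close>-th dual factor by
  \<open>j\<close> moves the entry \<open>m\<close> from column \<open>j + 1\<close> to column
  \<open>j\<close>.\<close>

lemma star_e_dot_eq_Some_iff:
  assumes b: "b \<in> col_fam n l"
  shows "star (e_dot n j) b = Some b' \<longleftrightarrow> (\<exists>m \<in> b (j + 1) - b j. pivot (b (j + 1)) (b j) m
    \<and> b' = b(j := insert m (b j), j + 1 := b (j + 1) - {m}))"
proof -
  have "star (e_dot n j) b = Some b' \<longleftrightarrow> (\<exists>us m vs. [1..<n + 1] = us @ m # vs
    \<and> defect j (dual b) m = 1 \<and> balanced (defect j (dual b)) us vs
    \<and> dual b' = (dual b)(m := insert j (dual b m - {j + 1})))"
    unfolding star_eq_Some_iff e_dot_def by (rule e_op_eq_Some_iff) (use finite_dual[OF b] in blast)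
  also have "\<dots> \<longleftrightarrow> (\<exists>m\<in>{1..n}. defect j (dual b) m = 1 \<and> pivot (b (j + 1)) (b j) m
    \<and> dual b' = (dual b)(m := insert j (dual b m - {j + 1})))"
    unfolding split_upt_iff using balanced_dual_iff[OF b] by blast
  also have "\<dots> \<longleftrightarrow> (\<exists>m \<in> b (j + 1) - b j. pivot (b (j + 1)) (b j) m
    \<and> b' = b(j := insert m (b j), j + 1 := b (j + 1) - {m}))"
  proof -
    have "defect j (dual b) m = 1 \<longleftrightarrow> m \<in> b (j + 1) - b j" for m
      by (auto simp: defect_def dual_def of_bool_def split: if_splits)
    moreover have "b (j + 1) \<subseteq> {1..n}" using b by (auto simp: col_fam_def)
    moreover have "dual b' = (dual b)(m := insert j (dual b m - {j + 1})) \<longleftrightarrow>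
      b' = b(j := insert m (b j), j + 1 := b (j + 1) - {m})" for m
    proof -
      have "(dual b)(m := insert j (dual b m - {j + 1})) =
        dual (b(j := insert m (b j), j + 1 := b (j + 1) - {m}))"
        by (auto simp: dual_def fun_eq_iff)
      then show ?thesis by (metis dual_dual)
    qed
    ultimately show ?thesis by blast
  qed
  finally show ?thesis .
qed

lemma star_f_dot_eq_Some_iff:
  assumes b: "b \<in> col_fam n l"
  shows "star (f_dot n j) b = Some b' \<longleftrightarrow> (\<exists>m \<in> b j - b (j + 1). pivot (b (j + 1)) (b j) m
    \<and> b' = b(j := b j - {m}, j + 1 := insert m (b (j + 1))))"
proof -
  have "star (f_dot n j) b = Some b' \<longleftrightarrow> (\<exists>us m vs. [1..<n + 1] = us @ m # vs
    \<and> defect j (dual b) m = -1 \<and> balanced (defect j (dual b)) us vs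
    \<and> dual b' = (dual b)(m := insert (j + 1) (dual b m - {j})))"
    unfolding star_eq_Some_iff f_dot_def by (rule f_op_eq_Some_iff) (use finite_dual[OF b] in blast)
  also have "\<dots> \<longleftrightarrow> (\<exists>m\<in>{1..n}. defect j (dual b) m = -1 \<and> pivot (b (j + 1)) (b j) m
    \<and> dual b' = (dual b)(m := insert (j + 1) (dual b m - {j})))"
    unfolding split_upt_iff using balanced_dual_iff[OF b] by blast
  also have "\<dots> \<longleftrightarrow> (\<exists>m \<in> b j - b (j + 1). pivot (b (j + 1)) (b j) m
    \<and> b' = b(j := b j - {m}, j + 1 := insert m (b (j + 1))))"
  proof -
    have "defect j (dual b) m = -1 \<longleftrightarrow> m \<in> b j - b (j + 1)" for m
      by (auto simp: defect_def dual_def of_bool_def split: if_splits)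
    moreover have "b j \<subseteq> {1..n}" using b by (auto simp: col_fam_def)
    moreover have "dual b' = (dual b)(m := insert (j + 1) (dual b m - {j})) \<longleftrightarrow>
      b' = b(j := b j - {m}, j + 1 := insert m (b (j + 1)))" for m
    proof -
      have "(dual b)(m := insert (j + 1) (dual b m - {j})) =
        dual (b(j := b j - {m}, j + 1 := insert m (b (j + 1))))"
        by (auto simp: dual_def fun_eq_iff)
      then show ?thesis by (metis dual_dual)
    qed
    ultimately show ?thesis by blast
  qed
  finally show ?thesis .
qed

lemma col_fam_e_dot:
  assumes b: "b \<in> col_fam n l" and j: "j \<in> {1..l - 1}" and e: "star (e_dot n j) b = Some b'"
  shows "b' \<in> col_fam n l"
proof -
  obtain m where m: "m \<in> b (j + 1) - b j" and eq: "b' = b(j := insert m (b j), j + 1 := b (j + 1) - {m})"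
    using e unfolding star_e_dot_eq_Some_iff[OF b] by blast
  have b': "b' k \<subseteq> insert m (b k)" "k \<noteq> j \<and> k \<noteq> j + 1 \<Longrightarrow> b' k = b k" for k
    unfolding eq by auto
  have sub: "b k \<subseteq> {1..n}" for k using b by (simp add: col_fam_def)
  have "b' k \<subseteq> {1..n}" for k using sub b'(1) m by blast
  moreover have "b' k = {}" if "k \<notin> {1..l}" for k
  proof -
    have "k \<noteq> j \<and> k \<noteq> j + 1" using that j by auto
    then show ?thesis using b'(2)[of k] b that by (simp add: col_fam_def)
  qed
  ultimately show ?thesis by (simp add: col_fam_def)
qed

lemma col_fam_f_dot:
  assumes b: "b \<in> col_fam n l" and j: "j \<in> {1..l - 1}" and e: "star (f_dot n j) b = Some b'"
  shows "b' \<in> col_fam n l"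
proof -
  obtain m where m: "m \<in> b j - b (j + 1)" and eq: "b' = b(j := b j - {m}, j + 1 := insert m (b (j + 1)))"
    using e unfolding star_f_dot_eq_Some_iff[OF b] by blast
  have b': "b' k \<subseteq> insert m (b k)" "k \<noteq> j \<and> k \<noteq> j + 1 \<Longrightarrow> b' k = b k" for k
    unfolding eq by auto
  have sub: "b k \<subseteq> {1..n}" for k using b by (simp add: col_fam_def)
  have "b' k \<subseteq> {1..n}" for k using sub b'(1) m by blast
  moreover have "b' k = {}" if "k \<notin> {1..l}" for k
  proof -
    have "k \<noteq> j \<and> k \<noteq> j + 1" using that j by auto
    then show ?thesis using b'(2)[of k] b that by (simp add: col_fam_def)
  qed
  ultimately show ?thesis by (simp add: col_fam_def)
qed

lemma star_f_dot_iff_e_dot: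
  assumes b: "b \<in> col_fam n l" and b': "b' \<in> col_fam n l"
  shows "star (f_dot n j) b = Some b' \<longleftrightarrow> star (e_dot n j) b' = Some b"
  unfolding star_eq_Some_iff e_dot_def f_dot_def
  using f_op_eq_Some_iff_e_op[of "[1..<n + 1]" "dual b" j "dual b'"] finite_dual[OF b] finite_dual[OF b']
  by auto

section \<open>String lengths\<close>

lemma iter_Suc_front: "iter g (Suc m) x = Option.bind (g x) (iter g m)"
proof (induction m arbitrary: x)
  case 0
  show ?case by (cases "g x") simp_all
next
  case (Suc m)
  show ?case
    by (subst iter.simps(2), subst Suc.IH) (cases "g x"; simp)
qed

lemma iter_map_option:
  assumes z: "z \<in> S" and closed: "\<And>z z'. z \<in> S \<Longrightarrow> g z = Some z' \<Longrightarrow> z' \<in> S"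
    and g: "\<And>z. z \<in> S \<Longrightarrow> g' (h z) = map_option h (g z)"
  shows "iter g' k (h z) = map_option h (iter g k z)"
proof -
  have "iter g' k (h z) = map_option h (iter g k z) \<and> (\<forall>z'. iter g k z = Some z' \<longrightarrow> z' \<in> S)"
  proof (induction k)
    case (Suc k)
    then show ?case using closed g by (cases "iter g k z") auto
  qed (use z in auto)
  then show ?thesis by blast
qed

text \<open>A rank dropping by one with each application excludes the junk value of \<^const>\<open>Max\<close>.\<close>

lemma string_len_eq:
  fixes rank :: "'a \<Rightarrow> nat"
  assumes x: "x \<in> S"
    and none: "\<And>z. z \<in> S \<Longrightarrow> g z = None \<longleftrightarrow> rank z = 0"
    and some: "\<And>z z'. z \<in> S \<Longrightarrow> g z = Some z' \<Longrightarrow> z' \<in> S \<and> rank z = Suc (rank z')"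
  shows "string_len g x = rank x" and "iter g m x \<noteq> None \<longleftrightarrow> m \<le> rank x"
proof -
  have *: "iter g m x \<noteq> None \<longleftrightarrow> m \<le> rank x" for m
    using x
  proof (induction m arbitrary: x)
    case (Suc m)
    then show ?case
      using none[OF Suc.prems] some[OF Suc.prems]
      by (cases "g x") (auto simp: iter_Suc_front simp del: iter.simps)
  qed simp
  then have "{m. iter g m x \<noteq> None} = {..rank x}" by auto
  then show "string_len g x = rank x"
    unfolding string_len_def by (simp add: Max_eq_iff)
  show "iter g m x \<noteq> None \<longleftrightarrow> m \<le> rank x" by (rule *)
qed

section \<open>Maximal heights and string lengths\<close>

text \<open>Indices up to \<open>n\<close> suffice since the height is constant from there on. Index
  0, where the height vanishes, is included, so the maximum is never negative; it turns out to be
  the raising string length of the dual family.\<close>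

definition top_height :: "nat \<Rightarrow> nat set \<Rightarrow> nat set \<Rightarrow> int" where
  "top_height n y x = Max (height y x ` {..n})"

lemma top_height_ge:
  assumes "y \<subseteq> {1..n}" "x \<subseteq> {1..n}"
  shows "height y x k \<le> top_height n y x"
proof -
  have "height y x k = height y x (min k n)"
    using height_const[OF assms, of k] by (cases "k \<le> n") auto
  also have "\<dots> \<le> top_height n y x" unfolding top_height_def by (intro Max_ge) auto
  finally show ?thesis .
qed

lemma ex_top_height: "\<exists>k\<le>n. height y x k = top_height n y x"
proof -
  have "top_height n y x \<in> height y x ` {..n}" unfolding top_height_def by (intro Max_in) auto
  then show ?thesis by auto
qed

lemma top_height_eqI:
  assumes "y \<subseteq> {1..n}" "x \<subseteq> {1..n}" "\<And>k. height y x k \<le> M" "height y x k = M"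
  shows "top_height n y x = M"
proof (rule antisym)
  obtain p where "height y x p = top_height n y x" using ex_top_height[of n y x] by blast
  with assms(3)[of p] show "top_height n y x \<le> M" by simp
  show "M \<le> top_height n y x" using top_height_ge[OF assms(1,2), of k] assms(4) by simp
qed

lemma height_move:
  assumes "m \<in> y - x" "1 \<le> m"
  shows "height (y - {m}) (insert m x) k = height y x k - (if m \<le> k then 2 else 0)"
proof (induction k)
  case (Suc k)
  then show ?case
    using assms by (cases "m = Suc k") (auto simp: height_Suc of_bool_def)
qed (use assms in auto)

lemma pivot_minus:
  assumes "pivot y x m" "m \<in> y - x"
  shows "height y x m = height y x (m - 1) + 1" "k < m \<Longrightarrow> height y x k < height y x m"
    "height y x k \<le> height y x m"
proof -
  show *: "height y x m = height y x (m - 1) + 1"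
    using assms by (subst height_step) (auto simp: pivot_def)
  show "k < m \<Longrightarrow> height y x k < height y x m" using * assms by (force simp: pivot_def)
  then show "height y x k \<le> height y x m"
    using * assms by (cases "k < m"; cases "k = m") (auto simp: pivot_def)
qed

lemma ex_pivot_minus:
  assumes yx: "y \<subseteq> {1..n}" "x \<subseteq> {1..n}" and "0 < top_height n y x"
  shows "\<exists>m\<in>y - x. pivot y x m"
proof -
  let ?h = "height y x" and ?M = "top_height n y x"
  \<comment> \<open>The height must rise strictly into its first maximum, which makes that index an
    element of \<open>y\<close> outside \<open>x\<close>. The index is not 0, because the maximum is
    positive.\<close>
  define m where "m = (LEAST k. ?h k = ?M)"
  obtain k0 where "?h k0 = ?M" using ex_top_height[of n y x] by blast
  then have m: "?h m = ?M" unfolding m_def by (rule LeastI)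
  have lt: "?h k \<le> ?M - 1" if "k < m" for k
    using not_less_Least[of k "\<lambda>k. ?h k = ?M"] that top_height_ge[OF yx, of k] unfolding m_def by force
  have "1 \<le> m" using m assms(3) by (cases m) auto
  then have st: "?h m = ?h (m - 1) + (of_bool (m \<in> y) - of_bool (m \<in> x))" by (rule height_step)
  have "?h (m - 1) \<le> ?M - 1" using lt \<open>1 \<le> m\<close> by simp
  with st m have "m \<in> y - x" "?h (m - 1) = ?M - 1" by (auto simp: of_bool_def split: if_splits)
  moreover from this have "pivot y x m"
    using \<open>1 \<le> m\<close> lt top_height_ge[OF yx] m by (auto simp: pivot_def)
  ultimately show ?thesis by blast
qed

lemma pivot_plus:
  assumes "pivot y x m" "m \<in> x - y"
  shows "height y x (m - 1) = height y x m + 1" "m \<le> k \<Longrightarrow> height y x k < height y x (m - 1)"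
proof -
  show *: "height y x (m - 1) = height y x m + 1"
    using assms height_step[of m y x] by (auto simp: pivot_def)
  show "m \<le> k \<Longrightarrow> height y x k < height y x (m - 1)"
    using * assms by (cases "k = m") (force simp: pivot_def)+
qed

text \<open>Lowering acts directly after the last maximum: the height drops there, so the next index
  lies in \<open>x\<close> only. The last maximum comes before \<open>n\<close> because the final
  height is smaller.\<close>

lemma ex_pivot_plus:
  assumes yx: "y \<subseteq> {1..n}" "x \<subseteq> {1..n}" and "height y x n < top_height n y x"
  shows "\<exists>m\<in>x - y. pivot y x m"
proof -
  let ?h = "height y x" and ?M = "top_height n y x"
  define p where "p = (GREATEST k. k \<le> n \<and> ?h k = ?M)"
  obtain k0 where k0: "k0 \<le> n \<and> ?h k0 = ?M" using ex_top_height[of n y x] by blast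
  have p: "p \<le> n \<and> ?h p = ?M" unfolding p_def by (rule GreatestI_nat[of _ k0 n]) (use k0 in auto)
  have "p \<noteq> n" using p assms(3) by auto
  have lt: "?h k \<le> ?M - 1" if "p < k" for k
  proof (cases "k \<le> n")
    case True
    have "?h k \<noteq> ?M"
      using Greatest_le_nat[of "\<lambda>k. k \<le> n \<and> ?h k = ?M" k n] True that unfolding p_def by force
    then show ?thesis using top_height_ge[OF yx, of k] by simp
  next
    case False
    then show ?thesis using height_const[OF yx, of k] assms(3) by simp
  qed
  have st: "?h (Suc p) = ?h p + (of_bool (Suc p \<in> y) - of_bool (Suc p \<in> x))" by (rule height_Suc)
  have "?h (Suc p) \<le> ?M - 1" using lt by simp
  with st p have "Suc p \<in> x - y" "?h (Suc p) = ?M - 1" by (auto simp: of_bool_def split: if_splits)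
  moreover from this have "pivot y x (Suc p)"
    using p lt top_height_ge[OF yx] by (auto simp: pivot_def)
  ultimately show ?thesis by blast
qed

text \<open>Before \<open>m\<close> all values are below the maximum M and remain unchanged, from
  \<open>m\<close> on they drop by 2. The value M - 1 at \<open>m - 1\<close> survives and is the
  new maximum.\<close>

lemma top_height_move:
  assumes yx: "y \<subseteq> {1..n}" "x \<subseteq> {1..n}" and m: "pivot y x m" "m \<in> y - x"
  shows "top_height n y x = top_height n (y - {m}) (insert m x) + 1"
    and "height y x n = height (y - {m}) (insert m x) n + 2"
proof -
  have m1: "1 \<le> m" "m \<le> n" using m yx by (auto simp: pivot_def)
  have 1: "top_height n y x = height y x m"
    by (rule top_height_eqI[OF yx]) (use pivot_minus[OF m] in auto)
  have 2: "top_height n (y - {m}) (insert m x) = height y x m - 1"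
  proof (rule top_height_eqI)
    show "y - {m} \<subseteq> {1..n}" "insert m x \<subseteq> {1..n}" using yx m1 by auto
    show "height (y - {m}) (insert m x) (m - 1) = height y x m - 1"
      using height_move[OF m(2) m1(1)] pivot_minus[OF m] m1 by simp
    show "height (y - {m}) (insert m x) k \<le> height y x m - 1" for k
      using height_move[OF m(2) m1(1), of k] pivot_minus(2,3)[OF m, of k] by auto
  qed
  from 1 2 show "top_height n y x = top_height n (y - {m}) (insert m x) + 1" by simp
  show "height y x n = height (y - {m}) (insert m x) n + 2"
    using height_move[OF m(2) m1(1), of n] m1 by simp
qed

lemma star_e_dot_eq_None_iff:
  assumes b: "b \<in> col_fam n l"
  shows "star (e_dot n j) b = None \<longleftrightarrow> top_height n (b (j + 1)) (b j) = 0"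
proof -
  note sub = col_fam_subset[OF b, of "j + 1"] col_fam_subset[OF b, of j]
  have "star (e_dot n j) b = None \<longleftrightarrow> \<not> (\<exists>m\<in>b (j + 1) - b j. pivot (b (j + 1)) (b j) m)"
    using star_e_dot_eq_Some_iff[OF b, of j] by (metis not_None_eq)
  also have "(\<exists>m\<in>b (j + 1) - b j. pivot (b (j + 1)) (b j) m) \<longleftrightarrow> 0 < top_height n (b (j + 1)) (b j)"
  proof
    assume "\<exists>m\<in>b (j + 1) - b j. pivot (b (j + 1)) (b j) m"
    then obtain m where m: "m \<in> b (j + 1) - b j" "pivot (b (j + 1)) (b j) m" by blast
    then have "0 < height (b (j + 1)) (b j) m"
      using pivot_minus(2)[OF m(2,1), of 0] by (simp add: pivot_def)
    then show "0 < top_height n (b (j + 1)) (b j)" using top_height_ge[OF sub, of m] by simp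
  qed (rule ex_pivot_minus[OF sub])
  finally show ?thesis using top_height_ge[OF sub, of 0] by auto
qed

lemma star_f_dot_eq_None_iff:
  assumes b: "b \<in> col_fam n l"
  shows "star (f_dot n j) b = None \<longleftrightarrow> top_height n (b (j + 1)) (b j) = height (b (j + 1)) (b j) n"
proof -
  note sub = col_fam_subset[OF b, of "j + 1"] col_fam_subset[OF b, of j]
  have "star (f_dot n j) b = None \<longleftrightarrow> \<not> (\<exists>m\<in>b j - b (j + 1). pivot (b (j + 1)) (b j) m)"
    using star_f_dot_eq_Some_iff[OF b, of j] by (metis not_None_eq)
  also have "(\<exists>m\<in>b j - b (j + 1). pivot (b (j + 1)) (b j) m)
    \<longleftrightarrow> height (b (j + 1)) (b j) n < top_height n (b (j + 1)) (b j)"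
  proof
    assume "\<exists>m\<in>b j - b (j + 1). pivot (b (j + 1)) (b j) m"
    then obtain m where m: "m \<in> b j - b (j + 1)" "pivot (b (j + 1)) (b j) m" by blast
    with sub have "m \<le> n" by auto
    then show "height (b (j + 1)) (b j) n < top_height n (b (j + 1)) (b j)"
      using pivot_plus(2)[OF m(2,1)] top_height_ge[OF sub, of "m - 1"] by fastforce
  qed (rule ex_pivot_plus[OF sub])
  finally show ?thesis using top_height_ge[OF sub, of n] by auto
qed

lemma star_e_dot_top_height:
  assumes b: "b \<in> col_fam n l" and e: "star (e_dot n j) b = Some b'"
  shows "top_height n (b (j + 1)) (b j) = top_height n (b' (j + 1)) (b' j) + 1"
    and "height (b (j + 1)) (b j) n = height (b' (j + 1)) (b' j) n + 2"
proof -
  note sub = col_fam_subset[OF b, of "j + 1"] col_fam_subset[OF b, of j]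
  obtain m where m: "m \<in> b (j + 1) - b j" "pivot (b (j + 1)) (b j) m"
    and b': "b' = b(j := insert m (b j), j + 1 := b (j + 1) - {m})"
    using e star_e_dot_eq_Some_iff[OF b] by blast
  show "top_height n (b (j + 1)) (b j) = top_height n (b' (j + 1)) (b' j) + 1"
    and "height (b (j + 1)) (b j) n = height (b' (j + 1)) (b' j) n + 2"
    using top_height_move[OF sub m(2,1)] unfolding b' by simp_all
qed

lemma string_len_e_dot:
  assumes b: "b \<in> col_fam n l" and j: "j \<in> {1..l - 1}"
  shows "string_len (star (e_dot n j)) b = nat (top_height n (b (j + 1)) (b j))"
    and "iter (star (e_dot n j)) m b \<noteq> None \<longleftrightarrow> m \<le> nat (top_height n (b (j + 1)) (b j))"
proof -
  have nonneg: "0 \<le> top_height n (z (j + 1)) (z j)" if "z \<in> col_fam n l" for z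
    using top_height_ge[of "z (j + 1)" n "z j" 0] col_fam_subset[OF that] by simp
  note * = string_len_eq[of b "col_fam n l" "star (e_dot n j)" "\<lambda>z. nat (top_height n (z (j + 1)) (z j))"]
  have 1: "star (e_dot n j) z = None \<longleftrightarrow> nat (top_height n (z (j + 1)) (z j)) = 0"
    if "z \<in> col_fam n l" for z
    using star_e_dot_eq_None_iff[OF that] nonneg[OF that] by simp
  have 2: "z' \<in> col_fam n l \<and> nat (top_height n (z (j + 1)) (z j)) = Suc (nat (top_height n (z' (j + 1)) (z' j)))"
    if "z \<in> col_fam n l" "star (e_dot n j) z = Some z'" for z z'
    using col_fam_e_dot[OF that(1) j that(2)] star_e_dot_top_height[OF that] nonneg
    by (simp add: nat_add_distrib)
  show "string_len (star (e_dot n j)) b = nat (top_height n (b (j + 1)) (b j))"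
    and "iter (star (e_dot n j)) m b \<noteq> None \<longleftrightarrow> m \<le> nat (top_height n (b (j + 1)) (b j))"
    using *[OF b 1 2] by blast+
qed

lemma string_len_f_dot:
  assumes b: "b \<in> col_fam n l" and j: "j \<in> {1..l - 1}"
  shows "string_len (star (f_dot n j)) b
      = nat (top_height n (b (j + 1)) (b j) - height (b (j + 1)) (b j) n)"
    and "iter (star (f_dot n j)) m b \<noteq> None \<longleftrightarrow>
      m \<le> nat (top_height n (b (j + 1)) (b j) - height (b (j + 1)) (b j) n)"
proof -
  let ?r = "\<lambda>z. top_height n (z (j + 1)) (z j) - height (z (j + 1)) (z j) n"
  have nonneg: "0 \<le> ?r z" if "z \<in> col_fam n l" for z
    using top_height_ge[of "z (j + 1)" n "z j" n] col_fam_subset[OF that] by simp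
  note * = string_len_eq[of b "col_fam n l" "star (f_dot n j)" "\<lambda>z. nat (?r z)"]
  have 1: "star (f_dot n j) z = None \<longleftrightarrow> nat (?r z) = 0" if "z \<in> col_fam n l" for z
    using star_f_dot_eq_None_iff[OF that, of j] nonneg[OF that] by auto
  have 2: "z' \<in> col_fam n l \<and> nat (?r z) = Suc (nat (?r z'))"
    if z: "z \<in> col_fam n l" "star (f_dot n j) z = Some z'" for z z'
  proof -
    have z': "z' \<in> col_fam n l" by (rule col_fam_f_dot[OF z(1) j z(2)])
    have "star (e_dot n j) z' = Some z" using star_f_dot_iff_e_dot[OF z(1) z'] z(2) by blast
    \<comment> \<open>Raising \<open>z'\<close> to \<open>z\<close> lowers the maximum by 1 and the
      final height by 2, so their difference grows by 1.\<close>
    from star_e_dot_top_height[OF z' this] have "?r z = ?r z' + 1" by simp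
    with z' nonneg[OF z'] show ?thesis by (simp add: nat_add_distrib)
  qed
  show "string_len (star (f_dot n j)) b = nat (?r b)"
    and "iter (star (f_dot n j)) m b \<noteq> None \<longleftrightarrow> m \<le> nat (?r b)"
    using *[OF b 1 2] by blast+
qed

lemma star_iter: "star (iter g m) = iter (star g) m"
proof (induction m)
  case (Suc m)
  have "star (iter g (Suc m)) b = iter (star g) (Suc m) b" for b
    by (cases "iter g m (dual b)") (simp_all add: Suc.IH[symmetric] star_def)
  then show ?case by blast
qed (auto simp: star_def)

lemma string_len_dual: "string_len g (dual b) = string_len (star g) b"
proof -
  have "iter g m (dual b) = None \<longleftrightarrow> iter (star g) m b = None" for m
    using star_iter[of g m] by (metis star_def option.map_disc_iff)
  then show ?thesis by (simp add: string_len_def)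
qed

text \<open>The lowering and raising string lengths are M - h(n) and M with the same maximum M of
  the height h. Their difference is -h(n), the size of column \<open>j\<close> minus that of column
  \<open>j + 1\<close>.\<close>

lemma star_sigma_dot:
  assumes b: "b \<in> col_fam n l" and j: "j \<in> {1..l - 1}"
  shows "star (sigma_dot n j) b = (if card (b (j + 1)) \<le> card (b j)
    then iter (star (f_dot n j)) (card (b j) - card (b (j + 1))) b
    else iter (star (e_dot n j)) (card (b (j + 1)) - card (b j)) b)"
proof -
  note sub = col_fam_subset[OF b, of "j + 1"] col_fam_subset[OF b, of j]
  let ?t = "top_height n (b (j + 1)) (b j)"
  have h: "height (b (j + 1)) (b j) n = int (card (b (j + 1))) - int (card (b j))"
    by (rule height_total[OF sub])
  have t: "0 \<le> ?t" "height (b (j + 1)) (b j) n \<le> ?t"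
    using top_height_ge[OF sub, of 0] top_height_ge[OF sub, of n] by simp_all
  have p: "string_len (f_dot n j) (dual b) = nat (?t - (int (card (b (j + 1))) - int (card (b j))))"
    unfolding string_len_dual string_len_f_dot[OF b j] h ..
  have q: "string_len (e_dot n j) (dual b) = nat ?t"
    unfolding string_len_dual string_len_e_dot[OF b j] ..
  have "star (sigma_dot n j) b = (let p = string_len (f_dot n j) (dual b); q = string_len (e_dot n j) (dual b) in
     if p \<ge> q then iter (star (f_dot n j)) (p - q) b else iter (star (e_dot n j)) (q - p) b)"
    by (simp add: star_def sigma_dot_def Let_def star_iter[symmetric])
  moreover have "string_len (e_dot n j) (dual b) \<le> string_len (f_dot n j) (dual b)
    \<longleftrightarrow> card (b (j + 1)) \<le> card (b j)"
    using t h unfolding p q by linarith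
  moreover have "string_len (f_dot n j) (dual b) - string_len (e_dot n j) (dual b) = card (b j) - card (b (j + 1))"
    "string_len (e_dot n j) (dual b) - string_len (f_dot n j) (dual b) = card (b (j + 1)) - card (b j)"
    using t h unfolding p q by linarith+
  ultimately show ?thesis by (simp add: Let_def)
qed

section \<open>Commutation of the two crystal structures\<close>

text \<open>Stated for arbitrary functions, so that it can be followed when a single value of the
  height is modified.\<close>

definition first_max :: "(nat \<Rightarrow> int) \<Rightarrow> nat \<Rightarrow> bool" where
  "first_max h m \<longleftrightarrow> 1 \<le> m \<and> (\<forall>k<m. h k < h m) \<and> (\<forall>k. h k \<le> h m)"

text \<open>The height changes by at most 1 per step, and it rises into \<open>m\<close> exactly
  when \<open>m\<close> lies in \<open>y\<close> but not in \<open>x\<close>. With this rise the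
  one-sided conditions of \<open>pivot\<close> become strict maximality before \<open>m\<close> and
  weak maximality after it.\<close>

lemma first_max_height_iff: "first_max (height y x) m \<longleftrightarrow> m \<in> y - x \<and> pivot y x m"
proof
  assume L: "first_max (height y x) m"
  then have m: "1 \<le> m" "height y x (m - 1) < height y x m" by (auto simp: first_max_def)
  with height_step[OF m(1), of y x] have *: "m \<in> y - x" "height y x m = height y x (m - 1) + 1"
    by (auto simp: of_bool_def split: if_splits)
  with L show "m \<in> y - x \<and> pivot y x m" by (auto simp: first_max_def pivot_def)
next
  assume R: "m \<in> y - x \<and> pivot y x m"
  then have "pivot y x m" "m \<in> y - x" by blast+
  from pivot_minus(2,3)[OF this] this(1) show "first_max (height y x) m"
    unfolding first_max_def pivot_def by blast
qed

lemma star_e_dot_first_max: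
  assumes "b \<in> col_fam n l"
  shows "star (e_dot n j) b = Some b' \<longleftrightarrow> (\<exists>m. first_max (height (b (j + 1)) (b j)) m
    \<and> b' = b(j := insert m (b j), j + 1 := b (j + 1) - {m}))"
  unfolding star_e_dot_eq_Some_iff[OF assms] first_max_height_iff by blast

lemma option_eqI: "(\<And>y. x = Some y \<longleftrightarrow> x' = Some y) \<Longrightarrow> x = x'"
  by (cases x; cases x') auto

section \<open>The crystal operators on two columns\<close>

text \<open>The tensor product rule. Column 2 is read first: its \<open>-\<close> is the rightmost
  one only if column 1 contributes none, and the \<open>-\<close> of column 1 survives only if
  column 2 contributes no \<open>+\<close>.\<close>

lemma e_op_pair:
  assumes "finite (z 2)" "finite (z 1)"
  shows "e_op [2, 1] i z =
    (if i + 1 \<in> z 2 \<and> i \<notin> z 2 \<and> (i + 1 \<in> z 1 \<longrightarrow> i \<in> z 1) then Some (z(2 := insert i (z 2 - {i + 1})))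
     else if i + 1 \<in> z 1 \<and> i \<notin> z 1 \<and> (i \<in> z 2 \<longrightarrow> i + 1 \<in> z 2) then Some (z(1 := insert i (z 1 - {i + 1})))
     else None)" (is "_ = ?r")
proof -
  have split: "[2, 1] = us @ k # vs \<longleftrightarrow> us = [] \<and> k = 2 \<and> vs = [1] \<or> us = [2] \<and> k = 1 \<and> vs = []"
    for us vs and k :: nat
    by (auto simp: Cons_eq_append_conv)
  have 1: "balanced d [] [1] \<longleftrightarrow> d 1 \<le> 0" "balanced d [2] [] \<longleftrightarrow> 0 \<le> d 2" for d :: "nat \<Rightarrow> int"
    by (auto simp: balanced_def Cons_eq_append_conv)
  have fin: "finite (z k)" if "k \<in> set [2, 1]" for k using that assms by auto
  have ex: "(\<exists>us k vs. (us = [] \<and> k = 2 \<and> vs = [1] \<or> us = [2] \<and> k = 1 \<and> vs = []) \<and> P us k vs)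
    \<longleftrightarrow> P [] 2 [1] \<or> P [2] 1 []" for P :: "nat list \<Rightarrow> nat \<Rightarrow> nat list \<Rightarrow> bool"
    by blast
  have iff: "e_op [2, 1] i z = Some z' \<longleftrightarrow> (\<exists>us k vs. [2, 1] = us @ k # vs
    \<and> defect i z k = 1 \<and> balanced (defect i z) us vs \<and> z' = z(k := insert i (z k - {i + 1})))" for z'
    by (rule e_op_eq_Some_iff) (use fin in blast)
  have d: "defect i z k = 1 \<longleftrightarrow> i + 1 \<in> z k \<and> i \<notin> z k"
    "defect i z k \<le> 0 \<longleftrightarrow> (i + 1 \<in> z k \<longrightarrow> i \<in> z k)"
    "0 \<le> defect i z k \<longleftrightarrow> (i \<in> z k \<longrightarrow> i + 1 \<in> z k)" for k
    by (auto simp: defect_def of_bool_def split: if_splits)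
  have "e_op [2, 1] i z = Some z' \<longleftrightarrow>
      defect i z 2 = 1 \<and> defect i z 1 \<le> 0 \<and> z' = z(2 := insert i (z 2 - {i + 1}))
    \<or> defect i z 1 = 1 \<and> 0 \<le> defect i z 2 \<and> z' = z(1 := insert i (z 1 - {i + 1}))" for z'
    unfolding iff split ex 1 by blast
  then have "e_op [2, 1] i z = Some z' \<longleftrightarrow> ?r = Some z'" for z'
    unfolding d by (simp only: option.inject split: if_split) blast
  then show ?thesis by (rule option_eqI)
qed

lemma e_op_pair_right:
  assumes "finite (z 2)" "finite (z 1)" "i + 1 \<in> z 2" "i \<notin> z 2" "i + 1 \<in> z 1 \<Longrightarrow> i \<in> z 1"
    and "z' = z(2 := insert i (z 2 - {i + 1}))"
  shows "e_op [2, 1] i z = Some z'"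
  using assms by (simp add: e_op_pair del: One_nat_def)

lemma e_op_pair_left:
  assumes "finite (z 2)" "finite (z 1)" "i + 1 \<in> z 1" "i \<notin> z 1" "i \<in> z 2 \<Longrightarrow> i + 1 \<in> z 2"
    and "z' = z(1 := insert i (z 1 - {i + 1}))"
  shows "e_op [2, 1] i z = Some z'"
  using assms by (auto simp: e_op_pair simp del: One_nat_def)

text \<open>\<open>right\<close> and \<open>left\<close> refer to the two-column tableau, where
  column 2 is the right column, although it is the left tensor factor.\<close>

lemma e_op_pair_cases [consumes 3, case_names right left]:
  assumes "finite (z 2)" "finite (z 1)" "e_op [2, 1] i z = Some z'"
  obtains
    (right) "i + 1 \<in> z 2" "i \<notin> z 2" "i + 1 \<in> z 1 \<longrightarrow> i \<in> z 1" "z' = z(2 := insert i (z 2 - {i + 1}))"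
  | (left) "i + 1 \<in> z 1" "i \<notin> z 1" "i \<in> z 2 \<longrightarrow> i + 1 \<in> z 2" "z' = z(1 := insert i (z 1 - {i + 1}))"
proof (cases "i + 1 \<in> z 2 \<and> i \<notin> z 2 \<and> (i + 1 \<in> z 1 \<longrightarrow> i \<in> z 1)")
  case True
  then have "e_op [2, 1] i z = Some (z(2 := insert i (z 2 - {i + 1})))"
    unfolding e_op_pair[OF assms(1,2)] by (rule if_P)
  with True right assms(3) show ?thesis by simp
next
  case False
  then have "e_op [2, 1] i z = (if i + 1 \<in> z 1 \<and> i \<notin> z 1 \<and> (i \<in> z 2 \<longrightarrow> i + 1 \<in> z 2)
    then Some (z(1 := insert i (z 1 - {i + 1}))) else None)"
    unfolding e_op_pair[OF assms(1,2)] by (rule if_not_P)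
  with left assms(3) show ?thesis
    by (cases "i + 1 \<in> z 1 \<and> i \<notin> z 1 \<and> (i \<in> z 2 \<longrightarrow> i + 1 \<in> z 2)") auto
qed

lemma height_raise_right:
  assumes "i + 1 \<in> y" "i \<notin> y" "1 \<le> i"
  shows "height (insert i (y - {i + 1})) x = (height y x)(i := height y x i + 1)"
proof
  fix k show "height (insert i (y - {i + 1})) x k = ((height y x)(i := height y x i + 1)) k"
  proof (induction k)
    case (Suc k)
    then show ?case
      using assms by (cases "k = i"; cases "Suc k = i") (auto simp: height_Suc)
  qed (use assms in auto)
qed

lemma height_raise_left:
  assumes "i + 1 \<in> x" "i \<notin> x" "1 \<le> i"
  shows "height y (insert i (x - {i + 1})) = (height y x)(i := height y x i - 1)"
proof
  fix k show "height y (insert i (x - {i + 1})) k = ((height y x)(i := height y x i - 1)) k"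
  proof (induction k)
    case (Suc k)
    then show ?case
      using assms by (cases "k = i"; cases "Suc k = i") (auto simp: height_Suc)
  qed (use assms in auto)
qed

abbreviation e_star :: "nat \<Rightarrow> cols \<Rightarrow> cols option" where
  "e_star n \<equiv> star (e_dot n 1)"

abbreviation f_star :: "nat \<Rightarrow> cols \<Rightarrow> cols option" where
  "f_star n \<equiv> star (f_dot n 1)"

lemma e_star_eq_Some_iff:
  assumes "z \<in> col_fam n 2"
  shows "e_star n z = Some z' \<longleftrightarrow>
    (\<exists>m. first_max (height (z 2) (z 1)) m \<and> z' = z(1 := insert m (z 1), 2 := z 2 - {m}))"
  using star_e_dot_first_max[OF assms, of 1 z'] by (simp add: numeral_2_eq_2)

lemma e_op_col_fam:
  assumes z: "z \<in> col_fam n 2" and i: "i \<in> {1..n - 1}" and e: "e_op [2, 1] i z = Some z'"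
  shows "z' \<in> col_fam n 2 \<and> card (z' 2) = card (z 2) \<and> card (z' 1) = card (z 1)"
proof -
  have fin: "finite (z k)" for k using finite_col_fam z by blast
  have "i \<in> {1..n}" using i by auto
  have card: "card (insert i (A - {i + 1})) = card A" if "finite A" "i + 1 \<in> A" "i \<notin> A" for A
    using that card_Suc_Diff1[of A "i + 1"] by simp
  have sub: "z' k \<subseteq> insert i (z k)" "k \<notin> {1..2} \<Longrightarrow> z' k = z k" for k
    using fin fin e by (cases rule: e_op_pair_cases; auto)+
  have "z' \<in> col_fam n 2"
    using z sub \<open>i \<in> {1..n}\<close> unfolding col_fam_def by blast
  moreover have "card (z' 2) = card (z 2) \<and> card (z' 1) = card (z 1)"
    using fin fin e
  proof (cases rule: e_op_pair_cases)
    case right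
    then show ?thesis using card[OF fin right(1,2)] by simp
  next
    case left
    then show ?thesis using card[OF fin left(1,2)] by simp
  qed
  ultimately show ?thesis by blast
qed

lemma height_around:
  assumes "1 \<le> i"
  shows "height y x i = height y x (i - 1) + (of_bool (i \<in> y) - of_bool (i \<in> x))"
    "height y x (i + 1) = height y x i + (of_bool (i + 1 \<in> y) - of_bool (i + 1 \<in> x))"
  using height_step[OF assms, of y x] height_Suc[of y x i] by simp_all

section \<open>First maxima under the change of one value\<close>

text \<open>A neighbour of \<open>i\<close> exceeds \<open>h i\<close>, so the raised value stays
  within the maximum. If \<open>i < m\<close>, both neighbours lie before \<open>m\<close> too, as
  \<open>m\<close> is not \<open>i + 1\<close>, and the inequality stays strict.\<close>

lemma first_max_up:
  assumes m: "first_max h m" "m \<noteq> i" "m \<noteq> i + 1"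
    and h: "h i + 1 \<le> h (i - 1) \<or> h i + 1 \<le> h (i + 1)"
  shows "first_max (h(i := h i + 1)) m"
proof -
  have m': "1 \<le> m" "\<And>k. k < m \<Longrightarrow> h k < h m" "\<And>k. h k \<le> h m"
    using m by (auto simp: first_max_def)
  have "h i + 1 \<le> h m" using h m'(3)[of "i - 1"] m'(3)[of "i + 1"] by linarith
  moreover have "h i + 1 < h m" if "i < m"
    using h m'(2)[of "i - 1"] m'(2)[of "i + 1"] that m(3) by fastforce
  ultimately show ?thesis using m' m(2) by (simp add: first_max_def)
qed

lemma first_max_down:
  assumes "first_max h m" "m \<noteq> i"
  shows "first_max (h(i := h i - 1)) m"
proof -
  have m': "1 \<le> m" "\<And>k. k < m \<Longrightarrow> h k < h m" "\<And>k. h k \<le> h m"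
    using assms by (auto simp: first_max_def)
  have "(h(i := h i - 1)) k < h m" if "k < m" for k
    using m'(2)[OF that] by auto
  moreover have "(h(i := h i - 1)) k \<le> h m" for k
    using m'(3)[of k] by auto
  ultimately show ?thesis using assms(2) m'(1) by (simp add: first_max_def)
qed

text \<open>The value just before the first maximum is lifted to the same level, and all earlier
  values were strictly smaller, so the first maximum moves one place to the left.
  \<open>first_max_shift_down\<close> is the opposite move: of two adjacent maxima the first is
  lowered.\<close>

lemma first_max_shift_up:
  assumes "first_max h (i + 1)" "h i + 1 = h (i + 1)" "1 \<le> i"
  shows "first_max (h(i := h i + 1)) i"
proof -
  have m': "\<And>k. k < i + 1 \<Longrightarrow> h k < h (i + 1)" "\<And>k. h k \<le> h (i + 1)"
    using assms by (auto simp: first_max_def)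
  have "(h(i := h i + 1)) k < h i + 1" if "k < i" for k
    using m'(1)[of k] that assms(2) by simp
  moreover have "(h(i := h i + 1)) k \<le> h i + 1" for k
    using m'(2)[of k] assms(2) by simp
  ultimately show ?thesis using assms(3) by (simp add: first_max_def)
qed

lemma first_max_shift_down:
  assumes "first_max h i" "h (i + 1) = h i"
  shows "first_max (h(i := h i - 1)) (i + 1)"
proof -
  have m': "\<And>k. k < i \<Longrightarrow> h k < h i" "\<And>k. h k \<le> h i"
    using assms by (auto simp: first_max_def)
  then show ?thesis using assms(2) by (auto simp: first_max_def less_Suc_eq)
qed

text \<open>
  An \<open>A\<^bsub>n-1\<^esub>\<close> operator changes the height at \<open>i\<close> only, by \<open>1\<close>; the entry moved between the columns
  stays the same unless it is \<open>i\<close> or \<open>i + 1\<close>, in which case the two are exchanged.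
\<close>

lemma e_op_commute_Some:
  assumes z: "z \<in> col_fam n 2" and i: "i \<in> {1..n - 1}"
    and E: "e_star n z = Some z1" and e: "e_op [2, 1] i z = Some z2"
  shows "\<exists>w. e_star n z2 = Some w \<and> e_op [2, 1] i z1 = Some w"
proof -
  let ?h = "height (z 2) (z 1)"
  have i1: "1 \<le> i" using i by simp
  have z1: "z1 \<in> col_fam n 2" by (rule col_fam_e_dot[OF z _ E]) simp
  have z2: "z2 \<in> col_fam n 2" using e_op_col_fam[OF z i e] by simp
  have fin: "finite (z k)" "finite (z1 k)" for k
    using finite_col_fam z z1 by blast+
  obtain m where m: "first_max ?h m" and z1_eq: "z1 = z(1 := insert m (z 1), 2 := z 2 - {m})"
    using E e_star_eq_Some_iff[OF z] by blast
  have mm: "m \<in> z 2" "m \<notin> z 1" using m unfolding first_max_height_iff by auto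
  have lt: "k < m \<Longrightarrow> ?h k < ?h m" and le: "?h k \<le> ?h m" and m1: "1 \<le> m" for k
    using m by (auto simp: first_max_def)
  note around = height_around[OF i1, of "z 2" "z 1"]
  show ?thesis
    using fin(1) fin(1) e
  proof (cases rule: e_op_pair_cases)
    case y: right
    have h2: "height (z2 2) (z2 1) = ?h(i := ?h i + 1)"
      using height_raise_right[OF y(1,2) i1, of "z 1"] y(4) by simp
    have "m \<noteq> i" using mm y by auto
    show ?thesis
    proof (cases "m = i + 1")
      case True
      \<comment> \<open>As column 2 has \<open>i + 1\<close> but not \<open>i\<close>, this
        difference is 1 minus the number of entries \<open>i\<close>, \<open>i + 1\<close> of column
        1; being positive, it leaves none of them there.\<close>
      have "?h (i - 1) < ?h (i + 1)" using lt[of "i - 1"] True by simp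
      with around y(1,2) have "i \<notin> z 1" by (auto simp: of_bool_def split: if_splits)
      have "first_max (height (z2 2) (z2 1)) i"
        unfolding h2
      proof (rule first_max_shift_up)
        show "?h i + 1 = ?h (i + 1)" using around(2) y(1-3) \<open>i \<notin> z 1\<close> by simp
      qed (use m True i1 in simp_all)
      moreover have "e_op [2, 1] i z1 = Some (z2(1 := insert i (z2 1), 2 := z2 2 - {i}))"
      proof (rule e_op_pair_left[OF fin(2) fin(2)])
        show "z2(1 := insert i (z2 1), 2 := z2 2 - {i}) = z1(1 := insert i (z1 1 - {i + 1}))"
          unfolding z1_eq y(4) using True mm y(1,2) by (auto simp: fun_eq_iff)
      qed (use y(1-3) mm True \<open>i \<notin> z 1\<close> in \<open>auto simp: z1_eq\<close>)
      ultimately show ?thesis using e_star_eq_Some_iff[OF z2] by blast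
    next
      case False
      \<comment> \<open>Column 1 contributes no \<open>-\<close>: either it lacks
        \<open>i + 1\<close> and the height rises after \<open>i\<close>, or it contains
        \<open>i\<close> as well and the height has just dropped into \<open>i\<close>.\<close>
      have "?h i + 1 \<le> ?h (i - 1) \<or> ?h i + 1 \<le> ?h (i + 1)" using around y(1-3) by (simp add: of_bool_def split: if_splits)
      then have "first_max (height (z2 2) (z2 1)) m"
        unfolding h2 by (rule first_max_up[OF m \<open>m \<noteq> i\<close> False])
      moreover have "e_op [2, 1] i z1 = Some (z2(1 := insert m (z2 1), 2 := z2 2 - {m}))"
      proof (rule e_op_pair_right[OF fin(2) fin(2)])
        show "z2(1 := insert m (z2 1), 2 := z2 2 - {m}) = z1(2 := insert i (z1 2 - {i + 1}))"
          unfolding z1_eq y(4) using False \<open>m \<noteq> i\<close> by (auto simp: fun_eq_iff)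
      qed (use y(1-3) mm False \<open>m \<noteq> i\<close> in \<open>auto simp: z1_eq\<close>)
      ultimately show ?thesis using e_star_eq_Some_iff[OF z2] by blast
    qed
  next
    case x: left
    have h2: "height (z2 2) (z2 1) = ?h(i := ?h i - 1)"
      using height_raise_left[OF x(1,2) i1, of "z 2"] x(4) by simp
    have "m \<noteq> i + 1" using mm x by auto
    show ?thesis
    proof (cases "m = i")
      case True
      have "first_max (height (z2 2) (z2 1)) (i + 1)"
        unfolding h2
      proof (rule first_max_shift_down)
        \<comment> \<open>The entry \<open>i\<close> is in column 2, so the signature rule puts
          \<open>i + 1\<close> there too, and its occurrences in both columns cancel in the
          height.\<close>
        show "?h (i + 1) = ?h i" using around(2) x(1-3) mm True by simp
      qed (use m True in simp)
      moreover have "e_op [2, 1] i z1 = Some (z2(1 := insert (i + 1) (z2 1), 2 := z2 2 - {i + 1}))"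
      proof (rule e_op_pair_right[OF fin(2) fin(2)])
        show "z2(1 := insert (i + 1) (z2 1), 2 := z2 2 - {i + 1}) = z1(2 := insert i (z1 2 - {i + 1}))"
          unfolding z1_eq x(4) using True mm x(1-3) by (auto simp: fun_eq_iff)
      qed (use x(1-3) mm True in \<open>auto simp: z1_eq\<close>)
      ultimately show ?thesis using e_star_eq_Some_iff[OF z2] by blast
    next
      case False
      have "first_max (height (z2 2) (z2 1)) m"
        unfolding h2 by (rule first_max_down[OF m False])
      moreover have "e_op [2, 1] i z1 = Some (z2(1 := insert m (z2 1), 2 := z2 2 - {m}))"
      proof (rule e_op_pair_left[OF fin(2) fin(2)])
        show "z2(1 := insert m (z2 1), 2 := z2 2 - {m}) = z1(1 := insert i (z1 1 - {i + 1}))"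
          unfolding z1_eq x(4) using False \<open>m \<noteq> i + 1\<close> by (auto simp: fun_eq_iff)
      qed (use x(1-3) mm False \<open>m \<noteq> i + 1\<close> in \<open>auto simp: z1_eq\<close>)
      ultimately show ?thesis using e_star_eq_Some_iff[OF z2] by blast
    qed
  qed
qed

text \<open>The dual raising operator vanishes exactly when no height is positive. A height is
  raised only next to a larger one, so none becomes positive.\<close>

lemma e_op_commute_None_left:
  assumes z: "z \<in> col_fam n 2" and i: "i \<in> {1..n - 1}"
    and E: "e_star n z = None" and e: "e_op [2, 1] i z = Some z2"
  shows "e_star n z2 = None"
proof -
  let ?h = "height (z 2) (z 1)"
  have i1: "1 \<le> i" using i by simp
  have z2: "z2 \<in> col_fam n 2" using e_op_col_fam[OF z i e] by simp
  have fin: "finite (z k)" for k using finite_col_fam z by blast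
  have "top_height n (z 2) (z 1) = 0"
    using star_e_dot_eq_None_iff[OF z, of 1] E unfolding one_add_one by blast
  then have le: "?h k \<le> 0" for k
    using top_height_ge[OF col_fam_subset[OF z, of 2] col_fam_subset[OF z, of 1], of k] by simp
  note around = height_around[OF i1, of "z 2" "z 1"]
  have le2: "height (z2 2) (z2 1) k \<le> 0" for k
    using fin fin e
  proof (cases rule: e_op_pair_cases)
    case y: right
    have "?h i + 1 \<le> ?h (i - 1) \<or> ?h i + 1 \<le> ?h (i + 1)"
      using around y(1-3) by (simp add: of_bool_def split: if_splits)
    then show ?thesis
      using height_raise_right[OF y(1,2) i1, of "z 1"] y(4) le[of k] le[of "i - 1"] le[of "i + 1"] by auto
  next
    case x: left
    then show ?thesis
      using height_raise_left[OF x(1,2) i1, of "z 2"] le[of k] by auto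
  qed
  have "\<not> first_max (height (z2 2) (z2 1)) m" for m
    using le2[of m] height_0[of "z2 2" "z2 1"] unfolding first_max_def by fastforce
  then show ?thesis using e_star_eq_Some_iff[OF z2] by (metis not_None_eq)
qed

lemma e_op_commute_None_right:
  assumes z: "z \<in> col_fam n 2" and i: "i \<in> {1..n - 1}"
    and E: "e_star n z = Some z1" and e: "e_op [2, 1] i z = None"
  shows "e_op [2, 1] i z1 = None"
proof -
  let ?h = "height (z 2) (z 1)"
  have i1: "1 \<le> i" using i by simp
  have z1: "z1 \<in> col_fam n 2" by (rule col_fam_e_dot[OF z _ E]) simp
  have fin: "finite (z k)" "finite (z1 k)" for k
    using finite_col_fam z z1 by blast+
  obtain m where m: "first_max ?h m" and z1_eq: "z1 = z(1 := insert m (z 1), 2 := z 2 - {m})"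
    using E e_star_eq_Some_iff[OF z] by blast
  have mm: "m \<in> z 2" "m \<notin> z 1" using m unfolding first_max_height_iff by auto
  have lt: "k < m \<Longrightarrow> ?h k < ?h m" and le: "?h k \<le> ?h m" and m1: "1 \<le> m" for k
    using m by (auto simp: first_max_def)
  note around = height_around[OF i1, of "z 2" "z 1"]
  have ez: "\<not> (i + 1 \<in> z 2 \<and> i \<notin> z 2 \<and> (i + 1 \<in> z 1 \<longrightarrow> i \<in> z 1))"
    "\<not> (i + 1 \<in> z 1 \<and> i \<notin> z 1 \<and> (i \<in> z 2 \<longrightarrow> i + 1 \<in> z 2))"
    using e unfolding e_op_pair[of z i, OF fin(1) fin(1)] by (auto split: if_splits)
  consider "m = i" | "m = i + 1" | "m \<noteq> i" "m \<noteq> i + 1" by blast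
  then have "\<not> (i + 1 \<in> z1 2 \<and> i \<notin> z1 2 \<and> (i + 1 \<in> z1 1 \<longrightarrow> i \<in> z1 1))
    \<and> \<not> (i + 1 \<in> z1 1 \<and> i \<notin> z1 1 \<and> (i \<in> z1 2 \<longrightarrow> i + 1 \<in> z1 2))"
  proof cases
    case 1
    \<comment> \<open>If column 2 contained \<open>i + 1\<close> as well, maximality at
      \<open>i\<close> would put \<open>i + 1\<close> into column 1, and \<open>e_op\<close> would
      have acted there.\<close>
    then show ?thesis using le[of "i + 1"] around ez mm unfolding z1_eq by (auto split: if_splits)
  next
    case 2
    then show ?thesis using lt[of "i - 1"] around ez mm unfolding z1_eq by (auto split: if_splits)
  next
    case 3
    then show ?thesis using ez unfolding z1_eq by auto
  qed
  then show ?thesis unfolding e_op_pair[of z1 i, OF fin(2) fin(2)] by auto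
qed

lemma e_op_e_star_commute:
  assumes z: "z \<in> col_fam n 2" and i: "i \<in> {1..n - 1}"
  shows "Option.bind (e_star n z) (e_op [2, 1] i) = Option.bind (e_op [2, 1] i z) (e_star n)"
  using e_op_commute_Some[OF z i] e_op_commute_None_left[OF z i] e_op_commute_None_right[OF z i]
  by (cases "e_star n z"; cases "e_op [2, 1] i z") (simp, simp, simp, force)

section \<open>The combinatorial R-matrix\<close>

lemma BB_iff: "z \<in> BB n p q \<longleftrightarrow> z \<in> col_fam n 2 \<and> card (z 2) = p \<and> card (z 1) = q"
proof
  assume R: "z \<in> col_fam n 2 \<and> card (z 2) = p \<and> card (z 1) = q"
  then have "k \<notin> {1..2} \<Longrightarrow> z k = {}" for k by (simp add: col_fam_def)
  moreover have "k \<in> {1..2} \<longleftrightarrow> k = 1 \<or> k = 2" for k :: nat by auto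
  ultimately have "z = tensor2 (z 2) (z 1)" by (auto simp: tensor2_def fun_eq_iff)
  then show "z \<in> BB n p q"
    using R unfolding BB_def col_fam_def by blast
next
  assume "z \<in> BB n p q"
  then obtain x y where z: "z = tensor2 x y" "x \<subseteq> {1..n}" "y \<subseteq> {1..n}" "card x = p" "card y = q"
    unfolding BB_def by blast
  have "z j \<subseteq> {1..n}" for j using z(2,3) unfolding z(1) tensor2_def by simp
  moreover have "z j = {}" if "j \<notin> {1..2}" for j using that unfolding z(1) tensor2_def by auto
  ultimately show "z \<in> col_fam n 2 \<and> card (z 2) = p \<and> card (z 1) = q"
    using z by (simp add: col_fam_def tensor2_def)
qed

lemma BB_col_fam: "z \<in> BB n p q \<Longrightarrow> z \<in> col_fam n 2"
  by (simp add: BB_iff)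

lemma e_op_BB: "z \<in> BB n p q \<Longrightarrow> i \<in> {1..n - 1} \<Longrightarrow> e_op [2, 1] i z = Some z' \<Longrightarrow> z' \<in> BB n p q"
  using e_op_col_fam[of z n i z'] unfolding BB_iff by simp

lemma f_op_pair_iff:
  assumes "z \<in> col_fam n 2" "z' \<in> col_fam n 2"
  shows "f_op [2, 1] i z = Some z' \<longleftrightarrow> e_op [2, 1] i z' = Some z"
  by (subst f_op_eq_Some_iff_e_op) (use finite_col_fam assms in auto)

lemma f_op_BB:
  assumes z: "z \<in> BB n p q" and i: "i \<in> {1..n - 1}" and f: "f_op [2, 1] i z = Some z'"
  shows "z' \<in> BB n p q"
proof -
  have z': "finite (z k)" for k using finite_col_fam BB_col_fam[OF z] by blast
  then obtain us k vs where *: "[2, 1] = us @ k # vs" "defect i z k = -1"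
    "z' = z(k := insert (i + 1) (z k - {i}))"
    using f f_op_eq_Some_iff[of "[2, 1]" z i z'] by blast
  have k: "k \<in> {1, 2}" using *(1) by (auto simp: Cons_eq_append_conv)
  have "i \<in> z k" "i + 1 \<notin> z k" using *(2) by (auto simp: defect_def of_bool_def split: if_splits)
  then have "card (insert (i + 1) (z k - {i})) = card (z k)"
    using z' card_Suc_Diff1[of "z k" i] by simp
  moreover have "i + 1 \<in> {1..n}" using i by auto
  ultimately show ?thesis
    using z k unfolding *(3) BB_iff col_fam_def by (auto split: if_splits)
qed

lemma count_list_distinct: "distinct xs \<Longrightarrow> count_list xs a = of_bool (a \<in> set xs)"
  by (induction xs) auto

lemma wt_pair:
  assumes "finite (z 2)" "finite (z 1)"
  shows "wt [2, 1] i z = (of_bool (i \<in> z 2) + of_bool (i \<in> z 1))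
    - (of_bool (i + 1 \<in> z 2) + of_bool (i + 1 \<in> z 1))"
proof -
  have "map snd (word [2, 1] z) = sorted_list_of_set (z 2) @ sorted_list_of_set (z 1)"
    by (simp add: word_def comp_def)
  then show ?thesis
    using assms by (simp add: wt_def count_list_distinct)
qed

text \<open>On these sets lowering is the inverse relation of raising, and the bijection transports
  this; string lengths agree because the iterates are intertwined. Only weights and raising
  operators remain to be checked.\<close>

lemma crystal_isoI:
  assumes A: "A = BB n p q" and B: "B = BB n p' q'" and bij: "bij_betw \<psi> A B"
    and wt: "\<And>z i. z \<in> A \<Longrightarrow> wt [2, 1] i (\<psi> z) = wt [2, 1] i z"
    and e: "\<And>z i. z \<in> A \<Longrightarrow> i \<in> {1..n - 1} \<Longrightarrow> e_op [2, 1] i (\<psi> z) = map_option \<psi> (e_op [2, 1] i z)"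
  shows "crystal_iso n A B \<psi>"
proof -
  have into: "\<psi> z \<in> B" if "z \<in> A" for z using bij that by (auto simp: bij_betw_def)
  have f: "f_op [2, 1] i (\<psi> z) = map_option \<psi> (f_op [2, 1] i z)" if z: "z \<in> A" and i: "i \<in> {1..n - 1}" for z i
  proof (rule option_eqI)
    fix w
    show "f_op [2, 1] i (\<psi> z) = Some w \<longleftrightarrow> map_option \<psi> (f_op [2, 1] i z) = Some w"
    proof
      assume f: "f_op [2, 1] i (\<psi> z) = Some w"
      then have w: "w \<in> B" using into[OF z] i f_op_BB unfolding B by blast
      then obtain v where v: "v \<in> A" "w = \<psi> v" using bij by (auto simp: bij_betw_def)
      have "e_op [2, 1] i w = Some (\<psi> z)"
        using f w into[OF z] f_op_pair_iff BB_col_fam unfolding B by blast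
      then obtain u where u: "e_op [2, 1] i v = Some u" "\<psi> u = \<psi> z"
        using e[OF v(1) i] v(2) by (cases "e_op [2, 1] i v") auto
      then have "u \<in> A" using v(1) i e_op_BB unfolding A by blast
      with u z bij have "u = z" by (auto simp: bij_betw_def inj_on_def)
      with u v(1) z have "f_op [2, 1] i z = Some v"
        using f_op_pair_iff BB_col_fam unfolding A by blast
      with v show "map_option \<psi> (f_op [2, 1] i z) = Some w" by simp
    next
      assume "map_option \<psi> (f_op [2, 1] i z) = Some w"
      then obtain v where v: "f_op [2, 1] i z = Some v" "w = \<psi> v" by auto
      then have vA: "v \<in> A" using z i f_op_BB unfolding A by blast
      then have "e_op [2, 1] i v = Some z"
        using v z f_op_pair_iff BB_col_fam unfolding A by blast
      then have "e_op [2, 1] i w = Some (\<psi> z)" using e[OF vA i] v(2) by simp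
      then show "f_op [2, 1] i (\<psi> z) = Some w"
        using into[OF z] into[OF vA] v(2) f_op_pair_iff BB_col_fam unfolding B by blast
    qed
  qed
  have string: "string_len g (\<psi> z) = string_len g z"
    if z: "z \<in> A" and cl: "\<And>z z'. z \<in> A \<Longrightarrow> g z = Some z' \<Longrightarrow> z' \<in> A"
      and g: "\<And>z. z \<in> A \<Longrightarrow> g (\<psi> z) = map_option \<psi> (g z)" for g z
  proof -
    have "iter g m (\<psi> z) = map_option \<psi> (iter g m z)" for m
      by (rule iter_map_option[where S = A]) (use z cl g in auto)
    then have "iter g m (\<psi> z) = None \<longleftrightarrow> iter g m z = None" for m by simp
    then show ?thesis by (simp add: string_len_def)
  qed
  show ?thesis
    unfolding crystal_iso_def
  proof (intro conjI ballI)
    fix z i assume z: "z \<in> A" and i: "i \<in> {1..n - 1}"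
    show "eps [2, 1] i (\<psi> z) = eps [2, 1] i z"
      by (rule string[OF z]) (use e i e_op_BB A in blast)+
    show "phi [2, 1] i (\<psi> z) = phi [2, 1] i z"
      by (rule string[OF z]) (use f i f_op_BB A in blast)+
  qed (use bij wt e f in auto)
qed

text \<open>Provides the isomorphism given by iterated lowering without a separate commutation
  argument for \<open>f_star\<close>.\<close>

lemma crystal_iso_inv:
  assumes A: "A = BB n p q" and B: "B = BB n p' q'" and iso: "crystal_iso n A B \<psi>"
    and wt: "\<And>z i. z \<in> A \<Longrightarrow> wt [2, 1] i (\<psi> z) = wt [2, 1] i z"
    and inv: "\<And>z. z \<in> A \<Longrightarrow> \<chi> (\<psi> z) = z"
  shows "crystal_iso n B A \<chi>"
proof (rule crystal_isoI[OF B A])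
  have bij: "bij_betw \<psi> A B" using iso by (simp add: crystal_iso_def)
  then have ex: "\<exists>z\<in>A. w = \<psi> z" if "w \<in> B" for w using that by (auto simp: bij_betw_def)
  show "bij_betw \<chi> B A"
    by (rule bij_betw_byWitness[where f' = \<psi>]) (use ex inv bij in \<open>force simp: bij_betw_def\<close>)+
  show "wt [2, 1] i (\<chi> w) = wt [2, 1] i w" if "w \<in> B" for w i
    using ex[OF that] wt inv by auto
  show "e_op [2, 1] i (\<chi> w) = map_option \<chi> (e_op [2, 1] i w)"
    if w: "w \<in> B" and i: "i \<in> {1..n - 1}" for w i
  proof -
    obtain z where z: "z \<in> A" "w = \<psi> z" using ex[OF w] by blast
    have "e_op [2, 1] i w = map_option \<psi> (e_op [2, 1] i z)"
      using iso z i by (simp add: crystal_iso_def)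
    moreover have "z' \<in> A" if "e_op [2, 1] i z = Some z'" for z'
      using that z(1) i e_op_BB unfolding A by blast
    ultimately show ?thesis using z inv by (cases "e_op [2, 1] i z") auto
  qed
qed

section \<open>Highest weight elements and uniqueness of isomorphisms\<close>

lemma sum_raise:
  fixes A :: "nat set"
  assumes "finite A" "i + 1 \<in> A" "i \<notin> A"
  shows "\<Sum>A = Suc (\<Sum>(insert i (A - {i + 1})))"
  using assms sum.remove[of A "i + 1" "\<lambda>x. x"] by simp

lemma initial_segment:
  assumes A: "A \<subseteq> {1..n}" and down: "\<And>i. i \<in> {1..n - 1} \<Longrightarrow> i + 1 \<in> A \<Longrightarrow> i \<in> A"
  shows "A = {1..card A}"
proof -
  have fin: "finite A" using A finite_subset by blast
  have seg: "A = {1..m}" if "\<And>a. a \<in> A \<Longrightarrow> a \<le> m" "m = 0 \<or> m \<in> A" for m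
  proof
    show "A \<subseteq> {1..m}" using A that(1) by force
    show "{1..m} \<subseteq> A"
    proof
      fix k assume k: "k \<in> {1..m}"
      then have "k \<le> m" "m \<in> A" using that(2) by auto
      then show "k \<in> A"
      proof (induction rule: inc_induct)
        case (step j)
        then have "j + 1 \<in> A" by simp
        then show ?case using down[of j] A step.hyps k by auto
      qed
    qed
  qed
  show ?thesis
  proof (cases "A = {}")
    case False
    then have "A = {1..Max A}" using fin by (intro seg) auto
    moreover have "card {1..Max A} = Max A" by simp
    ultimately show ?thesis by metis
  qed simp
qed

text \<open>Nothing stands before column 2 that could cancel its \<open>-\<close>. If it had
  \<open>i + 1\<close> without \<open>i\<close>, a \<open>-\<close> would survive, and
  \<open>e_op\<close> would act on one of the columns.\<close>

lemma highest_right: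
  assumes z: "z \<in> BB n p q" and h: "\<And>i. i \<in> {1..n - 1} \<Longrightarrow> e_op [2, 1] i z = None"
  shows "z 2 = {1..p}"
proof -
  have fin: "finite (z k)" for k using finite_col_fam BB_col_fam[OF z] by blast
  have "i \<in> z 2" if i: "i \<in> {1..n - 1}" "i + 1 \<in> z 2" for i
    using h[OF i(1)] i(2) unfolding e_op_pair[of z i, OF fin fin] by (auto split: if_splits)
  then have "z 2 = {1..card (z 2)}"
    using initial_segment[of "z 2" n] col_fam_subset[OF BB_col_fam[OF z]] by blast
  then show ?thesis using z by (simp add: BB_iff)
qed

lemma constant_of_steps:
  fixes g :: "nat \<Rightarrow> int"
  assumes "\<And>i. i \<in> {1..n - 1} \<Longrightarrow> g i = g (i + 1)" "i \<in> {1..n}"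
  shows "g i = g 1"
proof -
  have "1 \<le> i" "i \<le> n" using assms(2) by auto
  then show ?thesis
  proof (induction i rule: dec_induct)
    case (step k)
    then show ?case using assms(1)[of k] by simp
  qed simp
qed

text \<open>The weight records only differences of multiplicities of consecutive letters. Since
  column 2 is known, the indicator functions of the two first columns differ by a constant, and
  equal sizes force it to be 0.\<close>

lemma highest_unique:
  assumes z: "z \<in> BB n p q" and w: "w \<in> BB n p q"
    and hz: "\<And>i. i \<in> {1..n - 1} \<Longrightarrow> e_op [2, 1] i z = None"
    and hw: "\<And>i. i \<in> {1..n - 1} \<Longrightarrow> e_op [2, 1] i w = None"
    and wt: "\<And>i. i \<in> {1..n - 1} \<Longrightarrow> wt [2, 1] i z = wt [2, 1] i w"
  shows "z = w"
proof -
  have fin: "finite (z k)" "finite (w k)" for k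
    using finite_col_fam BB_col_fam[OF z] BB_col_fam[OF w] by blast+
  have sub: "z k \<subseteq> {1..n}" "w k \<subseteq> {1..n}" for k
    using col_fam_subset BB_col_fam[OF z] BB_col_fam[OF w] by blast+
  have 2: "z 2 = w 2" using highest_right[OF z hz] highest_right[OF w hw] by simp
  define g :: "nat \<Rightarrow> int" where "g i = of_bool (i \<in> z 1) - of_bool (i \<in> w 1)" for i
  have "g i = g (i + 1)" if "i \<in> {1..n - 1}" for i
    using wt[OF that] 2 unfolding g_def wt_pair[of z i, OF fin(1) fin(1)] wt_pair[of w i, OF fin(2) fin(2)]
    by simp
  then have const: "g i = g 1" if "i \<in> {1..n}" for i using constant_of_steps that by blast
  have card: "int (card A) = (\<Sum>i=1..n. of_bool (i \<in> A))" if "A \<subseteq> {1..n}" for A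
    using that by (simp add: Int_absorb1 Collect_mem_eq)
  have "(\<Sum>i=1..n. g i) = int (card (z 1)) - int (card (w 1))"
    unfolding g_def sum_subtractf card[OF sub(1)] card[OF sub(2)] ..
  also have "\<dots> = 0" using z w by (simp add: BB_iff)
  finally have "(\<Sum>i=1..n. g i) = 0" .
  moreover have "(\<Sum>i=1..n. g i) = (\<Sum>i=1..n. g 1)"
    by (rule sum.cong[OF refl]) (rule const)
  ultimately have "int n * g 1 = 0" by simp
  then have "g i = 0" if "i \<in> {1..n}" for i using const[OF that] that by auto
  then have "i \<in> z 1 \<longleftrightarrow> i \<in> w 1" if "i \<in> {1..n}" for i
    using \<open>\<And>i. i \<in> {1..n} \<Longrightarrow> g i = 0\<close>[OF that] by (simp add: g_def of_bool_def split: if_splits)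
  then have 1: "z 1 = w 1" using sub[of 1] by blast
  have "z k = w k" for k
  proof (cases "k \<in> {1..2}")
    case True
    then have "k = 1 \<or> k = 2" by auto
    then show ?thesis using 1 2 by auto
  next
    case False
    then show ?thesis using BB_col_fam[OF z] BB_col_fam[OF w] by (simp add: col_fam_def)
  qed
  then show ?thesis by blast
qed

text \<open>At a highest weight element both images are again of highest weight, with the same
  weight, hence equal. Otherwise some raising operator lowers the sum of all entries by 1; there the
  maps agree, and the lowering operator carries the agreement back.\<close>

lemma crystal_iso_unique:
  assumes iso: "crystal_iso n (BB n p q) (BB n q p) \<psi>" "crystal_iso n (BB n p q) (BB n q p) \<chi>"
    and z: "z \<in> BB n p q"
  shows "\<psi> z = \<chi> z"
  using z
proof (induction "\<Sum>(z 2) + \<Sum>(z 1)" arbitrary: z rule: less_induct)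
  case less
  have into: "\<psi> z \<in> BB n q p" "\<chi> z \<in> BB n q p" if "z \<in> BB n p q" for z
    using iso that by (auto simp: crystal_iso_def bij_betw_def)
  show ?case
  proof (cases "\<forall>i\<in>{1..n - 1}. e_op [2, 1] i z = None")
    case True
    show ?thesis
      by (rule highest_unique[OF into[OF less.prems]])
        (use iso less.prems True in \<open>simp_all add: crystal_iso_def\<close>)
  next
    case False
    then obtain i z' where i: "i \<in> {1..n - 1}" and z': "e_op [2, 1] i z = Some z'" by auto
    have BB: "z' \<in> BB n p q" using e_op_BB[OF less.prems i z'] .
    have fin: "finite (z k)" for k using finite_col_fam BB_col_fam[OF less.prems] by blast
    have "\<Sum>(z 2) + \<Sum>(z 1) = Suc (\<Sum>(z' 2) + \<Sum>(z' 1))"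
      using fin fin z'
    proof (cases rule: e_op_pair_cases)
      case right
      then show ?thesis using sum_raise[OF fin right(1,2)] by simp
    next
      case left
      then show ?thesis using sum_raise[OF fin left(1,2)] by simp
    qed
    then have "\<psi> z' = \<chi> z'" using less.hyps BB by simp
    moreover have "f_op [2, 1] i z' = Some z"
      using z' f_op_pair_iff BB_col_fam BB less.prems by blast
    then have "f_op [2, 1] i (\<psi> z') = Some (\<psi> z)" "f_op [2, 1] i (\<chi> z') = Some (\<chi> z)"
      using iso BB i by (simp_all add: crystal_iso_def)
    ultimately show ?thesis by simp
  qed
qed


text \<open>The definite description ranges over extensional functions, so \<open>\<psi>\<close> is
  identified with it after restriction; this remains an isomorphism because the operators stay in
  the domain.\<close>

lemma R_matrix_eq:
  assumes iso: "crystal_iso n (BB n p q) (BB n q p) \<psi>" and z: "z \<in> BB n p q"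
    and wt: "\<And>z i. z \<in> BB n p q \<Longrightarrow> wt [2, 1] i (\<psi> z) = wt [2, 1] i z"
  shows "R_matrix n p q z = \<psi> z"
proof -
  let ?A = "BB n p q" and ?r = "restrict \<psi> (BB n p q)"
  have r: "crystal_iso n ?A (BB n q p) ?r"
  proof (rule crystal_isoI[OF refl refl])
    show "bij_betw ?r ?A (BB n q p)"
      using iso by (simp add: crystal_iso_def cong: bij_betw_cong)
    show "wt [2, 1] i (?r z) = wt [2, 1] i z" if "z \<in> ?A" for z i
      using wt that by simp
    show "e_op [2, 1] i (?r z) = map_option ?r (e_op [2, 1] i z)" if z: "z \<in> ?A" and i: "i \<in> {1..n - 1}" for z i
    proof -
      have "e_op [2, 1] i (?r z) = map_option \<psi> (e_op [2, 1] i z)"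
        using iso z i by (simp add: crystal_iso_def)
      then show ?thesis using e_op_BB[OF z i] by (cases "e_op [2, 1] i z") auto
    qed
  qed
  have "R_matrix n p q = ?r"
    unfolding R_matrix_def
  proof (rule the_equality)
    show "?r \<in> extensional ?A \<and> crystal_iso n ?A (BB n q p) ?r" using r by simp
    fix \<chi> assume \<chi>: "\<chi> \<in> extensional ?A \<and> crystal_iso n ?A (BB n q p) \<chi>"
    show "\<chi> = ?r"
    proof (rule extensionalityI[of _ ?A])
      show "\<chi> z = ?r z" if "z \<in> ?A" for z using crystal_iso_unique[OF _ r that] \<chi> by blast
    qed (use \<chi> in auto)
  qed
  then show ?thesis using z by simp
qed

section \<open>Iterates of the dual operators as isomorphisms\<close>

lemma e_star_BB:
  assumes z: "z \<in> BB n p q" and e: "e_star n z = Some z'"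
  shows "0 < p \<and> z' \<in> BB n (p - 1) (q + 1) \<and> (\<forall>i. wt [2, 1] i z' = wt [2, 1] i z)"
proof -
  have zc: "z \<in> col_fam n 2" by (rule BB_col_fam[OF z])
  have z': "z' \<in> col_fam n 2" by (rule col_fam_e_dot[OF zc _ e]) simp
  have fin: "finite (z k)" "finite (z' k)" for k using finite_col_fam zc z' by blast+
  obtain m where m: "m \<in> z 2" "m \<notin> z 1" and eq: "z' = z(1 := insert m (z 1), 2 := z 2 - {m})"
    using e unfolding e_star_eq_Some_iff[OF zc] first_max_height_iff by blast
  have "wt [2, 1] i z' = wt [2, 1] i z" for i
    unfolding wt_pair[of z i, OF fin(1) fin(1)] wt_pair[of z' i, OF fin(2) fin(2)]
    unfolding eq using m by auto
  moreover have "0 < p" using z m fin by (auto simp: BB_iff card_gt_0_iff)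
  moreover have "z' \<in> BB n (p - 1) (q + 1)"
    using z z' m fin unfolding BB_iff eq by simp
  ultimately show ?thesis by blast
qed

lemma iter_e_star_BB:
  assumes z: "z \<in> BB n p q" and e: "iter (e_star n) k z = Some z'"
  shows "k \<le> p \<and> z' \<in> BB n (p - k) (q + k) \<and> (\<forall>i. wt [2, 1] i z' = wt [2, 1] i z)"
  using e
proof (induction k arbitrary: z')
  case (Suc k)
  then obtain w where w: "iter (e_star n) k z = Some w" "e_star n w = Some z'"
    by (cases "iter (e_star n) k z") auto
  with Suc.IH have *: "k \<le> p" "w \<in> BB n (p - k) (q + k)" "\<forall>i. wt [2, 1] i w = wt [2, 1] i z" by blast+
  have "p - k - 1 = p - Suc k" "q + k + 1 = q + Suc k" by simp_all
  with e_star_BB[OF *(2) w(2)] *(1,3) show ?case by simp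
qed (use z in auto)

lemma col_fam_iter_f_star:
  assumes "w \<in> col_fam n 2" "iter (f_star n) k w = Some z"
  shows "z \<in> col_fam n 2"
  using assms(2)
proof (induction k arbitrary: z)
  case (Suc k)
  then obtain u where u: "iter (f_star n) k w = Some u" "f_star n u = Some z"
    by (cases "iter (f_star n) k w") auto
  with Suc.IH have "u \<in> col_fam n 2" by blast
  from col_fam_f_dot[OF this _ u(2)] show ?case by simp
qed (use assms in auto)

text \<open>The last lowering step is the first raising step on the way back, so one iterate is
  unrolled at its end and the other at its beginning.\<close>

lemma iter_f_star_iff:
  assumes "z \<in> col_fam n 2" "w \<in> col_fam n 2"
  shows "iter (f_star n) k w = Some z \<longleftrightarrow> iter (e_star n) k z = Some w"
  using assms
proof (induction k arbitrary: z)
  case (Suc k)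
  have one: "1 \<in> {1..2 - 1 :: nat}" by simp
  have "iter (f_star n) (Suc k) w = Some z \<longleftrightarrow>
    (\<exists>v. v \<in> col_fam n 2 \<and> iter (f_star n) k w = Some v \<and> f_star n v = Some z)"
    using col_fam_iter_f_star[OF Suc.prems(2)] by (cases "iter (f_star n) k w") auto
  also have "\<dots> \<longleftrightarrow> (\<exists>v. v \<in> col_fam n 2 \<and> e_star n z = Some v \<and> iter (e_star n) k v = Some w)"
    using Suc.IH[OF _ Suc.prems(2)] star_f_dot_iff_e_dot[OF _ Suc.prems(1), of _ 1] by blast
  also have "\<dots> \<longleftrightarrow> iter (e_star n) (Suc k) z = Some w"
    using col_fam_e_dot[OF Suc.prems(1) one] by (cases "e_star n z") (auto simp: iter_Suc_front simp del: iter.simps)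
  finally show ?case .
qed auto

lemma iter_e_star_commute:
  assumes z: "z \<in> col_fam n 2" and i: "i \<in> {1..n - 1}"
  shows "Option.bind (iter (e_star n) k z) (e_op [2, 1] i) = Option.bind (e_op [2, 1] i z) (iter (e_star n) k)"
  using z
proof (induction k arbitrary: z)
  case 0
  then show ?case by (cases "e_op [2, 1] i z") auto
next
  case (Suc k)
  note comm = e_op_e_star_commute[OF Suc.prems i]
  have l: "Option.bind (e_op [2, 1] i z) (iter (e_star n) (Suc k))
    = Option.bind (Option.bind (e_op [2, 1] i z) (e_star n)) (iter (e_star n) k)"
    by (cases "e_op [2, 1] i z") (auto simp: iter_Suc_front simp del: iter.simps)
  show ?case
  proof (cases "e_star n z")
    case None
    with comm show ?thesis unfolding l by (simp add: iter_Suc_front del: iter.simps)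
  next
    case (Some w)
    have "w \<in> col_fam n 2" by (rule col_fam_e_dot[OF Suc.prems _ Some]) simp
    from Suc.IH[OF this] comm Some show ?thesis unfolding l
      by (simp add: iter_Suc_front del: iter.simps)
  qed
qed

text \<open>Here \<open>k\<close> is the final height, which cannot exceed the maximal one.\<close>

lemma iter_e_star_defined:
  assumes "z \<in> BB n (q + k) q"
  shows "iter (e_star n) k z \<noteq> None"
proof -
  have z: "z \<in> col_fam n 2" "card (z 2) = q + k" "card (z 1) = q" using assms by (auto simp: BB_iff)
  note sub = col_fam_subset[OF z(1), of 2] col_fam_subset[OF z(1), of 1]
  have "int k \<le> top_height n (z 2) (z 1)"
    using top_height_ge[OF sub, of n] height_total[OF sub] z by simp
  then have "k \<le> nat (top_height n (z (1 + 1)) (z 1))" unfolding one_add_one by simp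
  then show ?thesis using string_len_e_dot(2)[OF z(1), of 1] by simp
qed

text \<open>Here \<open>k\<close> is minus the final height, and the maximal height is at least
  0.\<close>

lemma iter_f_star_defined:
  assumes "z \<in> BB n p (p + k)"
  shows "iter (f_star n) k z \<noteq> None"
proof -
  have z: "z \<in> col_fam n 2" "card (z 2) = p" "card (z 1) = p + k" using assms by (auto simp: BB_iff)
  note sub = col_fam_subset[OF z(1), of 2] col_fam_subset[OF z(1), of 1]
  have "int k \<le> top_height n (z 2) (z 1) - height (z 2) (z 1) n"
    using top_height_ge[OF sub, of 0] height_total[OF sub] z by simp
  then have "k \<le> nat (top_height n (z (1 + 1)) (z 1) - height (z (1 + 1)) (z 1) n)"
    unfolding one_add_one by simp
  then show ?thesis using string_len_f_dot(2)[OF z(1), of 1] by simp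
qed

lemma iter_f_star_BB:
  assumes w: "w \<in> BB n q (q + k)"
  shows "\<exists>z \<in> BB n (q + k) q. iter (f_star n) k w = Some z \<and> iter (e_star n) k z = Some w"
proof -
  obtain z where z: "iter (f_star n) k w = Some z" using iter_f_star_defined[OF w] by auto
  have c: "z \<in> col_fam n 2" by (rule col_fam_iter_f_star[OF BB_col_fam[OF w] z])
  have e: "iter (e_star n) k z = Some w" using iter_f_star_iff[OF c BB_col_fam[OF w]] z by blast
  have "z \<in> BB n (card (z 2)) (card (z 1))" using c by (simp add: BB_iff)
  from iter_e_star_BB[OF this e] w have "z \<in> BB n (q + k) q" using c by (auto simp: BB_iff)
  with z e show ?thesis by blast
qed

lemma crystal_iso_iter_e_star:
  shows "crystal_iso n (BB n (q + k) q) (BB n q (q + k)) (\<lambda>z. the (iter (e_star n) k z))"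
    and "z \<in> BB n (q + k) q \<Longrightarrow> wt [2, 1] i (the (iter (e_star n) k z)) = wt [2, 1] i z"
proof -
  let ?A = "BB n (q + k) q" and ?B = "BB n q (q + k)"
  let ?\<psi> = "\<lambda>z. the (iter (e_star n) k z)" and ?\<chi> = "\<lambda>z. the (iter (f_star n) k z)"
  have \<psi>: "iter (e_star n) k z = Some (?\<psi> z)" if "z \<in> ?A" for z
    using iter_e_star_defined[OF that] by auto
  have into: "?\<psi> z \<in> ?B" if "z \<in> ?A" for z using iter_e_star_BB[OF that \<psi>[OF that]] by simp
  have inv: "?\<chi> (?\<psi> z) = z" if "z \<in> ?A" for z
  proof -
    have "iter (f_star n) k (?\<psi> z) = Some z"
      using \<psi>[OF that] iter_f_star_iff[OF BB_col_fam[OF that] BB_col_fam[OF into[OF that]]] by blast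
    then show ?thesis by simp
  qed
  show wt: "wt [2, 1] i (?\<psi> z) = wt [2, 1] i z" if "z \<in> ?A" for z i
    using iter_e_star_BB[OF that \<psi>[OF that]] by simp
  show "crystal_iso n ?A ?B ?\<psi>"
  proof (rule crystal_isoI[OF refl refl])
    show "bij_betw ?\<psi> ?A ?B"
    proof (rule bij_betw_byWitness[where f' = ?\<chi>])
      show "\<forall>z\<in>?A. ?\<chi> (?\<psi> z) = z" using inv by blast
      show "\<forall>w\<in>?B. ?\<psi> (?\<chi> w) = w" using iter_f_star_BB by fastforce
      show "?\<psi> ` ?A \<subseteq> ?B" using into by blast
      show "?\<chi> ` ?B \<subseteq> ?A" using iter_f_star_BB by fastforce
    qed
    show "wt [2, 1] i (?\<psi> z) = wt [2, 1] i z" if "z \<in> ?A" for z i using wt[OF that] .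
    show "e_op [2, 1] i (?\<psi> z) = map_option ?\<psi> (e_op [2, 1] i z)"
      if z: "z \<in> ?A" and i: "i \<in> {1..n - 1}" for z i
    proof -
      obtain v where "iter (e_star n) k z = Some v" using \<psi>[OF z] by blast
      then have "e_op [2, 1] i (?\<psi> z) = Option.bind (e_op [2, 1] i z) (iter (e_star n) k)"
        using iter_e_star_commute[OF BB_col_fam[OF z] i, of k] by simp
      also have "\<dots> = map_option ?\<psi> (e_op [2, 1] i z)"
        using \<psi> e_op_BB[OF z i] by (cases "e_op [2, 1] i z") auto
      finally show ?thesis .
    qed
  qed
qed

lemma iter_eq_R_matrix_e:
  assumes z: "z \<in> BB n (q + k) q"
  shows "iter (e_star n) k z = Some (R_matrix n (q + k) q z)"
  using R_matrix_eq[OF crystal_iso_iter_e_star(1) z crystal_iso_iter_e_star(2)]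
    iter_e_star_defined[OF z] by auto

lemma iter_eq_R_matrix_f:
  assumes w: "w \<in> BB n q (q + k)"
  shows "iter (f_star n) k w = Some (R_matrix n q (q + k) w)"
proof -
  let ?\<psi> = "\<lambda>z. the (iter (e_star n) k z)" and ?\<chi> = "\<lambda>z. the (iter (f_star n) k z)"
  have inv: "?\<chi> (?\<psi> z) = z" if z: "z \<in> BB n (q + k) q" for z
  proof -
    obtain v where v: "iter (e_star n) k z = Some v" using iter_e_star_defined[OF z] by auto
    have "v \<in> col_fam n 2" using iter_e_star_BB[OF z v] BB_col_fam by blast
    then have "iter (f_star n) k v = Some z" using v iter_f_star_iff[OF BB_col_fam[OF z]] by blast
    with v show ?thesis by simp
  qed
  have iso: "crystal_iso n (BB n q (q + k)) (BB n (q + k) q) ?\<chi>"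
    by (rule crystal_iso_inv[OF refl refl crystal_iso_iter_e_star(1) crystal_iso_iter_e_star(2) inv])
  have "wt [2, 1] i (?\<chi> v) = wt [2, 1] i v" if v: "v \<in> BB n q (q + k)" for v i
  proof -
    obtain z where z: "z \<in> BB n (q + k) q" "iter (f_star n) k v = Some z" "iter (e_star n) k z = Some v"
      using iter_f_star_BB[OF v] by blast
    then show ?thesis using crystal_iso_iter_e_star(2)[OF z(1), of i] by simp
  qed
  from R_matrix_eq[OF iso w this] show ?thesis using iter_f_star_defined[OF w] by auto
qed

section \<open>From two columns to a whole family\<close>

text \<open>The \<open>j\<close>-th dual operators involve only columns \<open>j\<close> and
  \<open>j + 1\<close>. Inserting a pair into a fixed family intertwines them with the operators for
  two columns, which reduces the reversal of strings to \<open>l = 2\<close>.\<close>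

definition put :: "cols \<Rightarrow> nat \<Rightarrow> cols \<Rightarrow> cols" where
  "put b j z = b(j + 1 := z 2, j := z 1)"

lemma put_apply: "put b j z j = z 1" "put b j z (j + 1) = z 2"
  by (simp_all add: put_def)

lemma put_col_fam:
  assumes "b \<in> col_fam n l" "j \<in> {1..l - 1}" "z \<in> col_fam n 2"
  shows "put b j z \<in> col_fam n l"
proof -
  have "put b j z k \<subseteq> {1..n}" for k
    using col_fam_subset[OF assms(1)] col_fam_subset[OF assms(3)] by (simp add: put_def)
  moreover have "put b j z k = {}" if "k \<notin> {1..l}" for k
  proof -
    have "k \<noteq> j" "k \<noteq> j + 1" using that assms(2) by auto
    then show ?thesis using assms(1) that by (simp add: put_def col_fam_def)
  qed
  ultimately show ?thesis by (simp add: col_fam_def)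
qed

lemma put_tensor2: "put b j (tensor2 (b (j + 1)) (b j)) = b"
  by (simp add: put_def tensor2_def fun_eq_iff)

lemma star_e_dot_put:
  assumes b: "b \<in> col_fam n l" "j \<in> {1..l - 1}" and z: "z \<in> col_fam n 2"
  shows "star (e_dot n j) (put b j z) = map_option (put b j) (e_star n z)"
proof (rule option_eqI)
  fix b'
  have "(put b j z)(j := insert m (z 1), j + 1 := z 2 - {m}) = put b j (z(1 := insert m (z 1), 2 := z 2 - {m}))" for m
    by (auto simp: put_def fun_eq_iff)
  then have "star (e_dot n j) (put b j z) = Some b' \<longleftrightarrow>
    (\<exists>m. first_max (height (z 2) (z 1)) m \<and> b' = put b j (z(1 := insert m (z 1), 2 := z 2 - {m})))"
    unfolding star_e_dot_first_max[OF put_col_fam[OF b z]] put_apply by metis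
  also have "\<dots> \<longleftrightarrow> (\<exists>z'. e_star n z = Some z' \<and> b' = put b j z')"
    unfolding e_star_eq_Some_iff[OF z] by blast
  finally show "star (e_dot n j) (put b j z) = Some b' \<longleftrightarrow> map_option (put b j) (e_star n z) = Some b'"
    by auto
qed

lemma f_star_eq_Some_iff:
  assumes "z \<in> col_fam n 2"
  shows "f_star n z = Some z' \<longleftrightarrow>
    (\<exists>m\<in>z 1 - z 2. pivot (z 2) (z 1) m \<and> z' = z(1 := z 1 - {m}, 2 := insert m (z 2)))"
  using star_f_dot_eq_Some_iff[OF assms, of 1 z'] unfolding one_add_one .

lemma star_f_dot_put:
  assumes b: "b \<in> col_fam n l" "j \<in> {1..l - 1}" and z: "z \<in> col_fam n 2"
  shows "star (f_dot n j) (put b j z) = map_option (put b j) (f_star n z)"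
proof (rule option_eqI)
  fix b'
  have "(put b j z)(j := z 1 - {m}, j + 1 := insert m (z 2)) = put b j (z(1 := z 1 - {m}, 2 := insert m (z 2)))" for m
    by (auto simp: put_def fun_eq_iff)
  then have "star (f_dot n j) (put b j z) = Some b' \<longleftrightarrow>
    (\<exists>m\<in>z 1 - z 2. pivot (z 2) (z 1) m \<and> b' = put b j (z(1 := z 1 - {m}, 2 := insert m (z 2))))"
    unfolding star_f_dot_eq_Some_iff[OF put_col_fam[OF b z]] put_apply by metis
  also have "\<dots> \<longleftrightarrow> (\<exists>z'. f_star n z = Some z' \<and> b' = put b j z')"
    unfolding f_star_eq_Some_iff[OF z] by blast
  finally show "star (f_dot n j) (put b j z) = Some b' \<longleftrightarrow> map_option (put b j) (f_star n z) = Some b'"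
    by auto
qed

lemma star_sigma_dot_eq_R_op:
  assumes b: "b \<in> col_fam n l" and j: "j \<in> {1..l - 1}"
  shows "star (sigma_dot n j) b = Some (R_op n j b)"
proof -
  let ?y = "b (j + 1)" and ?x = "b j"
  let ?z = "tensor2 ?y ?x"
  have z: "?z \<in> BB n (card ?y) (card ?x)"
    using col_fam_subset[OF b] unfolding BB_def by blast
  have R: "R_op n j b = put b j (R_matrix n (card ?y) (card ?x) ?z)"
    by (simp add: R_op_def put_def Let_def)
  have one: "1 \<in> {1..2 - 1 :: nat}" by simp
  have e: "iter (star (e_dot n j)) k b = map_option (put b j) (iter (e_star n) k ?z)" for k
  proof -
    have "iter (star (e_dot n j)) k (put b j ?z) = map_option (put b j) (iter (e_star n) k ?z)"
    proof (rule iter_map_option[where S = "col_fam n 2"])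
      show "z' \<in> col_fam n 2" if "w \<in> col_fam n 2" "e_star n w = Some z'" for w z'
        by (rule col_fam_e_dot[OF that(1) one that(2)])
    qed (rule BB_col_fam[OF z], rule star_e_dot_put[OF b j])
    then show ?thesis unfolding put_tensor2 .
  qed
  have f: "iter (star (f_dot n j)) k b = map_option (put b j) (iter (f_star n) k ?z)" for k
  proof -
    have "iter (star (f_dot n j)) k (put b j ?z) = map_option (put b j) (iter (f_star n) k ?z)"
    proof (rule iter_map_option[where S = "col_fam n 2"])
      show "z' \<in> col_fam n 2" if "w \<in> col_fam n 2" "f_star n w = Some z'" for w z'
        by (rule col_fam_f_dot[OF that(1) one that(2)])
    qed (rule BB_col_fam[OF z], rule star_f_dot_put[OF b j])
    then show ?thesis unfolding put_tensor2 .
  qed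
  show ?thesis
  proof (cases "card ?y \<le> card ?x")
    case True
    then have "iter (f_star n) (card ?x - card ?y) ?z = Some (R_matrix n (card ?y) (card ?x) ?z)"
      using iter_eq_R_matrix_f[of ?z n "card ?y" "card ?x - card ?y"] z by simp
    with True show ?thesis unfolding star_sigma_dot[OF b j] R f by simp
  next
    case False
    then have "iter (e_star n) (card ?y - card ?x) ?z = Some (R_matrix n (card ?y) (card ?x) ?z)"
      using iter_eq_R_matrix_e[of ?z n "card ?x" "card ?y - card ?x"] z by simp
    with False show ?thesis unfolding star_sigma_dot[OF b j] R e by simp
  qed
qed

section \<open>The jeu de taquin slide\<close>

lemma next_cell_1:
  "next_cell T (r, 1) = (case (T (r + 1, 1), T (r, 2)) of
     (None, None) \<Rightarrow> None
   | (Some u, None) \<Rightarrow> Some (r + 1, 1)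
   | (None, Some v) \<Rightarrow> Some (r, 2)
   | (Some u, Some v) \<Rightarrow> Some (if u \<le> v then (r + 1, 1) else (r, 2)))"
  unfolding next_cell_def prod.case one_add_one ..

lemma next_cell_2:
  "T (r, 3) = None \<Longrightarrow> next_cell T (r, 2) = (if T (r + 1, 2) = None then None else Some (r + 1, 2))"
  by (auto simp: next_cell_def split: option.splits)

lemma column_move_up:
  assumes "T (r, c) = None" "r \<noteq> r'"
  shows "column (T((r, c) := T (r', c), (r', c) := None)) = column T"
proof (intro ext set_eqI)
  fix c' a
  show "a \<in> column (T((r, c) := T (r', c), (r', c) := None)) c' \<longleftrightarrow> a \<in> column T c'"
  proof
    assume "a \<in> column T c'"
    then obtain \<rho> where \<rho>: "T (\<rho>, c') = Some a" by (auto simp: column_def)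
    show "a \<in> column (T((r, c) := T (r', c), (r', c) := None)) c'"
    proof (cases "(\<rho>, c') = (r', c)")
      case True
      then show ?thesis using \<rho> assms(2) by (auto simp: column_def intro!: exI[of _ r])
    next
      case False
      then show ?thesis using \<rho> assms(1) by (auto simp: column_def intro!: exI[of _ \<rho>])
    qed
  qed (auto simp: column_def split: if_splits)
qed

text \<open>Once in the right column the hole can only descend, which permutes cells but not the set
  of entries. \<open>N\<close> bounds the occupied rows and supplies the induction measure.\<close>

lemma column_jdt_right:
  assumes "T (r, 2) = None" "\<And>\<rho>. T (\<rho>, 3) = None" "\<And>\<rho>. N < \<rho> \<Longrightarrow> T (\<rho>, 2) = None"
  shows "column (jdt T (r, 2)) = column T"
  using assms
proof (induction "N - r" arbitrary: T r rule: less_induct)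
  case less
  show ?case
  proof (cases "T (r + 1, 2)")
    case None
    then have "next_cell T (r, 2) = None" using less.prems by (simp add: next_cell_2)
    then show ?thesis by (simp add: jdt.simps)
  next
    case (Some v)
    then have "r + 1 \<le> N" using less.prems(3)[of "r + 1"] by (cases "r + 1 \<le> N") auto
    let ?T = "T((r, 2) := T (r + 1, 2), (r + 1, 2) := None)"
    have "next_cell T (r, 2) = Some (r + 1, 2)" using less.prems Some by (simp add: next_cell_2)
    then have "column (jdt T (r, 2)) = column (jdt ?T (r + 1, 2))" by (subst jdt.simps) simp
    also have "\<dots> = column ?T"
      by (rule less.hyps) (use \<open>r + 1 \<le> N\<close> less.prems in auto)
    also have "\<dots> = column T"
      by (rule column_move_up[of T r 2 "r + 1"]) (use less.prems(1) in simp_all)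
    finally show ?thesis .
  qed
qed

text \<open>\<open>p\<close> is the row where the hole changes column. In the rows before, the entry
  below the hole wins, ties included; in row \<open>p\<close> the right entry \<open>v\<close> is
  strictly smaller than anything below. As \<open>v\<close> occurs in no other row, clearing its
  cell removes it from the column as a set.\<close>

lemma column_jdt_left:
  assumes "T (r, 1) = None" "\<And>\<rho>. T (\<rho>, 3) = None" "\<And>\<rho>. N < \<rho> \<Longrightarrow> T (\<rho>, 2) = None"
    and "r \<le> p" "\<And>q. r \<le> q \<Longrightarrow> q < p \<Longrightarrow> \<exists>u v. T (q + 1, 1) = Some u \<and> T (q, 2) = Some v \<and> u \<le> v"
    and "T (p, 2) = Some v" "\<And>u. T (p + 1, 1) = Some u \<Longrightarrow> v < u"
    and "\<And>\<rho>. T (\<rho>, 2) = Some v \<Longrightarrow> \<rho> = p"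
  shows "column (jdt T (r, 1)) 1 = insert v (column T 1) \<and> column (jdt T (r, 1)) 2 = column T 2 - {v}"
  using assms
proof (induction "p - r" arbitrary: T r rule: less_induct)
  case less
  show ?case
  proof (cases "r = p")
    case True
    let ?T = "T((r, 1) := T (r, 2), (r, 2) := None)"
    have "next_cell T (r, 1) = Some (r, 2)"
      using less.prems(6,7) True unfolding next_cell_1 by (auto split: option.splits)
    then have "jdt T (r, 1) = jdt ?T (r, 2)" by (subst jdt.simps) simp
    moreover have "column (jdt ?T (r, 2)) = column ?T"
    proof (rule column_jdt_right[where N = N])
      show "?T (\<rho>, 3) = None" for \<rho> using less.prems(2) by simp
      show "?T (\<rho>, 2) = None" if "N < \<rho>" for \<rho> using less.prems(3)[OF that] by simp
    qed simp
    ultimately have "column (jdt T (r, 1)) = column ?T" by simp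
    moreover have "column ?T 1 = insert v (column T 1)"
    proof (rule set_eqI)
      fix a
      show "a \<in> column ?T 1 \<longleftrightarrow> a \<in> insert v (column T 1)"
      proof
        assume "a \<in> insert v (column T 1)"
        then show "a \<in> column ?T 1"
        proof
          assume "a = v"
          then have "?T (p, 1) = Some a" using less.prems(6) True by simp
          then show ?thesis unfolding column_def by blast
        next
          assume "a \<in> column T 1"
          then obtain \<rho> where "T (\<rho>, 1) = Some a" by (auto simp: column_def)
          with less.prems(1) have "?T (\<rho>, 1) = Some a" by auto
          then show ?thesis unfolding column_def by blast
        qed
      qed (use less.prems(6) True in \<open>auto simp: column_def split: if_splits\<close>)
    qed
    moreover have "column ?T 2 = column T 2 - {v}"
    proof (rule set_eqI)
      fix a
      have "?T (\<rho>, 2) = Some a \<longleftrightarrow> T (\<rho>, 2) = Some a \<and> \<rho> \<noteq> r" for \<rho> by simp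
      moreover have "\<rho> \<noteq> r \<longleftrightarrow> a \<noteq> v" if "T (\<rho>, 2) = Some a" for \<rho>
        using less.prems(6) less.prems(8)[of \<rho>] True that by auto
      ultimately show "a \<in> column ?T 2 \<longleftrightarrow> a \<in> column T 2 - {v}"
        unfolding column_def by blast
    qed
    ultimately show ?thesis by simp
  next
    case False
    then have "r < p" using less.prems(4) by simp
    then obtain u w where uw: "T (r + 1, 1) = Some u" "T (r, 2) = Some w" "u \<le> w"
      using less.prems(5)[of r] by auto
    let ?T = "T((r, 1) := T (r + 1, 1), (r + 1, 1) := None)"
    have "next_cell T (r, 1) = Some (r + 1, 1)" using uw unfolding next_cell_1 by simp
    then have jdt: "jdt T (r, 1) = jdt ?T (r + 1, 1)" by (subst jdt.simps) simp
    have "column (jdt ?T (r + 1, 1)) 1 = insert v (column ?T 1)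
      \<and> column (jdt ?T (r + 1, 1)) 2 = column ?T 2 - {v}"
    proof (rule less.hyps)
      show "\<exists>u v. ?T (q + 1, 1) = Some u \<and> ?T (q, 2) = Some v \<and> u \<le> v"
        if "r + 1 \<le> q" "q < p" for q
        using less.prems(5)[of q] that by simp
      show "?T (\<rho>, 3) = None" for \<rho> using less.prems(2) by simp
      show "?T (\<rho>, 2) = None" if "N < \<rho>" for \<rho> using less.prems(3)[OF that] by simp
      show "v < u" if "?T (p + 1, 1) = Some u" for u
        using less.prems(7)[of u] that \<open>r < p\<close> by (simp split: if_splits)
      show "\<rho> = p" if "?T (\<rho>, 2) = Some v" for \<rho> using less.prems(8)[of \<rho>] that by simp
    qed (use \<open>r < p\<close> less.prems(6) in simp_all)
    moreover have "column ?T = column T"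
      by (rule column_move_up[of T r 1 "r + 1"]) (use less.prems(1) in simp_all)
    ultimately show ?thesis unfolding jdt by simp
  qed
qed

section \<open>Rows of the skew tableau and counting of entries\<close>

text \<open>Translates comparisons of entries in a row into cardinalities, and thereby into
  heights.\<close>

lemma nth_sorted_list_of_set_le_iff:
  fixes A :: "nat set"
  assumes "finite A" "a < card A"
  shows "sorted_list_of_set A ! a \<le> k \<longleftrightarrow> a < card (A \<inter> {..k})"
proof -
  let ?xs = "sorted_list_of_set A"
  define I where "I = {i. i < card A \<and> ?xs ! i \<le> k}"
  have mono: "?xs ! i \<le> ?xs ! j" if "i \<le> j" "j < card A" for i j
    using that assms(1) by (intro sorted_nth_mono) auto
  have "A \<inter> {..k} = (\<lambda>i. ?xs ! i) ` I"
  proof (rule set_eqI)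
    fix v
    have "v \<in> A \<longleftrightarrow> (\<exists>i<card A. ?xs ! i = v)"
      using assms(1) by (metis in_set_conv_nth length_sorted_list_of_set set_sorted_list_of_set)
    then show "v \<in> A \<inter> {..k} \<longleftrightarrow> v \<in> (\<lambda>i. ?xs ! i) ` I" by (auto simp: I_def)
  qed
  moreover have "inj_on (\<lambda>i. ?xs ! i) I"
    using assms(1) by (auto simp: I_def inj_on_def nth_eq_iff_index_eq)
  ultimately have card: "card (A \<inter> {..k}) = card I" by (simp add: card_image)
  have fin: "finite I" by (simp add: I_def)
  show ?thesis
  proof
    assume "?xs ! a \<le> k"
    then have "{..a} \<subseteq> I" using mono assms(2) by (fastforce simp: I_def)
    then have "card {..a} \<le> card I" by (rule card_mono[OF fin])
    then show "a < card (A \<inter> {..k})" by (simp add: card)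
  next
    assume *: "a < card (A \<inter> {..k})"
    show "?xs ! a \<le> k"
    proof (rule ccontr)
      assume "\<not> ?xs ! a \<le> k"
      then have "I \<subseteq> {..<a}" using mono[of a] by (force simp: I_def not_le)
      then have "card I \<le> card {..<a}" by (rule card_mono[rotated]) simp
      with * card show False by simp
    qed
  qed
qed

lemma card_le_nth_sorted_list_of_set:
  fixes A :: "nat set"
  assumes "finite A" "a < card A"
  shows "card (A \<inter> {..sorted_list_of_set A ! a}) = a + 1"
proof (rule antisym)
  let ?k = "sorted_list_of_set A ! a"
  show "a + 1 \<le> card (A \<inter> {..?k})"
    using nth_sorted_list_of_set_le_iff[OF assms, of ?k] by simp
  show "card (A \<inter> {..?k}) \<le> a + 1"
  proof (rule ccontr)
    assume *: "\<not> card (A \<inter> {..?k}) \<le> a + 1"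
    have "card (A \<inter> {..?k}) \<le> card A" using assms(1) by (intro card_mono) auto
    with * have "a + 1 < card A" by simp
    with * have "sorted_list_of_set A ! (a + 1) \<le> ?k"
      using nth_sorted_list_of_set_le_iff[OF assms(1), of "a + 1"] by simp
    moreover have "?k < sorted_list_of_set A ! (a + 1)"
      using sorted_wrt_nth_less[OF strict_sorted_list_of_set, of a "a + 1" A] \<open>a + 1 < card A\<close>
      by simp
    ultimately show False by simp
  qed
qed

lemma skew_1: "skew t x y (r, 1) = (if t + 1 \<le> r \<and> r \<le> t + card x
    then Some (sorted_list_of_set x ! (r - (t + 1))) else None)"
  by (simp add: skew_def)

lemma skew_2: "skew t x y (r, 2) = (if 1 \<le> r \<and> r \<le> card y
    then Some (sorted_list_of_set y ! (r - 1)) else None)"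
  by (simp add: skew_def)

lemma skew_3: "skew t x y (r, 3) = None"
  by (simp add: skew_def)

text \<open>If v is the entry of \<open>y\<close> in row \<open>r\<close>, exactly \<open>r\<close>
  entries of \<open>y\<close> are at most v, so the left neighbour is at most v if and only if the
  height at v is at most \<open>t\<close>. The size condition ensures that this neighbour exists for
  \<open>t < r\<close>. The valid shifts are therefore the upper bounds of the height.\<close>

lemma min_shift_eq:
  assumes "y \<subseteq> {1..n}" "x \<subseteq> {1..n}"
  shows "int (min_shift x y) = top_height n y x"
proof -
  have fin: "finite x" "finite y" using assms finite_subset by blast+
  have h: "height y x k = int (card (y \<inter> {..k})) - int (card (x \<inter> {..k}))" for k
    using assms by (intro height_eq_card) auto
  have card_le: "card (x \<inter> {..k}) \<le> card x" "card (y \<inter> {..k}) \<le> card y" for k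
    using fin by (intro card_mono; auto)+
  have valid: "t + card x \<ge> card y \<and>
     (\<forall>r u v. skew t x y (r, 1) = Some u \<longrightarrow> skew t x y (r, 2) = Some v \<longrightarrow> u \<le> v)
     \<longleftrightarrow> (\<forall>k. height y x k \<le> int t)" (is "?L \<longleftrightarrow> ?R") for t
  proof
    assume L: ?L
    show ?R
    proof
      fix k
      show "height y x k \<le> int t"
      \<comment> \<open>With at most \<open>t\<close> entries of \<open>y\<close> up to
        \<open>k\<close> the bound is immediate. Otherwise the last of them lies in a row that meets
        the left column, and the comparison in that row gives the bound.\<close>
      proof (cases "card (y \<inter> {..k}) \<le> t")
        case False
        define r where "r = card (y \<inter> {..k})"
        have r: "t < r" "r \<le> card y" "r \<le> t + card x"
          using False L card_le(2)[of k] by (auto simp: r_def)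
        then have "sorted_list_of_set x ! (r - (t + 1)) \<le> sorted_list_of_set y ! (r - 1)"
        proof -
          have "skew t x y (r, 1) = Some (sorted_list_of_set x ! (r - (t + 1)))"
            "skew t x y (r, 2) = Some (sorted_list_of_set y ! (r - 1))"
            using r unfolding skew_1 skew_2 by simp_all
          with L show ?thesis by blast
        qed
        also have "\<dots> \<le> k"
          using nth_sorted_list_of_set_le_iff[OF fin(2), of "r - 1" k] r by (simp add: r_def)
        finally have "r - (t + 1) < card (x \<inter> {..k})"
          using nth_sorted_list_of_set_le_iff[OF fin(1), of "r - (t + 1)" k] r by simp
        then show ?thesis unfolding h r_def[symmetric] using r by simp
      qed (simp add: h)
    qed
  next
    assume R: ?R
    have "height y x n \<le> int t" using R by blast
    then have "card y \<le> t + card x" using height_total[OF assms] by simp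
    moreover have "u \<le> v" if uv: "skew t x y (r, 1) = Some u" "skew t x y (r, 2) = Some v" for r u v
    proof -
      have r: "t + 1 \<le> r" "r \<le> t + card x" "1 \<le> r" "r \<le> card y"
        and u: "u = sorted_list_of_set x ! (r - (t + 1))" and v: "v = sorted_list_of_set y ! (r - 1)"
        using uv unfolding skew_1 skew_2 by (auto split: if_splits)
      have "card (y \<inter> {..v}) = r"
        using card_le_nth_sorted_list_of_set[OF fin(2), of "r - 1"] r unfolding v by simp
      moreover have "height y x v \<le> int t" using R by blast
      ultimately have "r - (t + 1) < card (x \<inter> {..v})" using r unfolding h by simp
      then show "u \<le> v"
        using nth_sorted_list_of_set_le_iff[OF fin(1), of "r - (t + 1)" v] r unfolding u by simp
    qed
    ultimately show ?L by blast
  qed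
  have nonneg: "0 \<le> top_height n y x" using top_height_ge[OF assms, of 0] by simp
  have "min_shift x y = nat (top_height n y x)"
    unfolding min_shift_def valid
  proof (rule Least_equality)
    show "\<forall>k. height y x k \<le> int (nat (top_height n y x))"
      using top_height_ge[OF assms] nonneg by simp
    show "nat (top_height n y x) \<le> t" if "\<forall>k. height y x k \<le> int t" for t
    proof -
      obtain k where "height y x k = top_height n y x" using ex_top_height[of n y x] by blast
      with that have "top_height n y x \<le> int t" by metis
      then show ?thesis by simp
    qed
  qed
  with nonneg show ?thesis by simp
qed

lemma column_skew:
  assumes "finite x" "finite y"
  shows "column (skew t x y) 1 = x" "column (skew t x y) 2 = y"
proof -
  have *: "v \<in> A \<longleftrightarrow> (\<exists>i<card A. sorted_list_of_set A ! i = v)" if "finite A" for v and A :: "nat set"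
    using that by (metis in_set_conv_nth length_sorted_list_of_set set_sorted_list_of_set)
  show "column (skew t x y) 1 = x"
  proof (rule set_eqI)
    fix v
    show "v \<in> column (skew t x y) 1 \<longleftrightarrow> v \<in> x"
    proof
      assume "v \<in> x"
      then obtain i where "i < card x" "sorted_list_of_set x ! i = v" using *[OF assms(1)] by blast
      then have "skew t x y (t + 1 + i, 1) = Some v" unfolding skew_1 by simp
      then show "v \<in> column (skew t x y) 1" unfolding column_def by blast
    next
      assume "v \<in> column (skew t x y) 1"
      then obtain r where "t + 1 \<le> r" "r \<le> t + card x" "v = sorted_list_of_set x ! (r - (t + 1))"
        unfolding column_def skew_1 by (auto split: if_splits)
      then show "v \<in> x" using *[OF assms(1), of v] by (auto intro!: exI[of _ "r - (t + 1)"])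
    qed
  qed
  show "column (skew t x y) 2 = y"
  proof (rule set_eqI)
    fix v
    show "v \<in> column (skew t x y) 2 \<longleftrightarrow> v \<in> y"
    proof
      assume "v \<in> y"
      then obtain i where "i < card y" "sorted_list_of_set y ! i = v" using *[OF assms(2)] by blast
      then have "skew t x y (1 + i, 2) = Some v" unfolding skew_2 by simp
      then show "v \<in> column (skew t x y) 2" unfolding column_def by blast
    next
      assume "v \<in> column (skew t x y) 2"
      then obtain r where "1 \<le> r" "r \<le> card y" "v = sorted_list_of_set y ! (r - 1)"
        unfolding column_def skew_2 by (auto split: if_splits)
      then show "v \<in> y" using *[OF assms(2), of v] by (auto intro!: exI[of _ "r - 1"])
    qed
  qed
qed

text \<open>The shift \<open>t\<close> is the height at \<open>m\<close>. If \<open>m\<close> is in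
  row \<open>p\<close>, exactly \<open>p - t\<close> entries of \<open>x\<close> are at most
  \<open>m\<close>, so the hole turns right in row \<open>p\<close>. In earlier rows the height is
  still below \<open>t\<close>, which means that the entry below the hole moves.\<close>

lemma column_jdt_skew:
  assumes yx: "y \<subseteq> {1..n}" "x \<subseteq> {1..n}" and m: "first_max (height y x) m"
    and t: "t = min_shift x y"
  shows "column (jdt (skew t x y) (t, 1)) 1 = insert m x \<and> column (jdt (skew t x y) (t, 1)) 2 = y - {m}"
proof -
  have fin: "finite x" "finite y" using yx finite_subset by blast+
  let ?xs = "sorted_list_of_set x" and ?ys = "sorted_list_of_set y"
  have h: "height y x k = int (card (y \<inter> {..k})) - int (card (x \<inter> {..k}))" for k
    using yx by (intro height_eq_card) auto
  have card_le: "card (x \<inter> {..k}) \<le> card x" for k using fin by (intro card_mono) auto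
  have m': "m \<in> y" "\<And>k. k < m \<Longrightarrow> height y x k < height y x m" "\<And>k. height y x k \<le> height y x m" "1 \<le> m"
    using m first_max_height_iff[of y x m] by (auto simp: first_max_def)
  have ht: "height y x m = int t"
    unfolding t min_shift_eq[OF yx] by (rule sym, rule top_height_eqI[OF yx m'(3) refl])
  have "0 < height y x m" using m'(2)[of 0] m'(4) by simp
  then have "0 < t" using ht by simp
  obtain i where i: "i < card y" "?ys ! i = m"
    using m'(1) fin(2) by (metis in_set_conv_nth length_sorted_list_of_set set_sorted_list_of_set)
  define p where "p = i + 1"
  have p: "1 \<le> p" "p \<le> card y" "?ys ! (p - 1) = m" using i by (auto simp: p_def)
  have Ym: "card (y \<inter> {..m}) = p"
    using card_le_nth_sorted_list_of_set[OF fin(2) i(1)] i(2) by (simp add: p_def)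
  have Xm: "card (x \<inter> {..m}) + t = p" using ht unfolding h Ym by simp
  have "column (jdt (skew t x y) (t, 1)) 1 = insert m (column (skew t x y) 1)
    \<and> column (jdt (skew t x y) (t, 1)) 2 = column (skew t x y) 2 - {m}"
  proof (rule column_jdt_left[where N = "card y" and p = p])
    show "skew t x y (t, 1) = None" unfolding skew_1 by simp
    show "skew t x y (\<rho>, 3) = None" for \<rho> by (rule skew_3)
    show "skew t x y (\<rho>, 2) = None" if "card y < \<rho>" for \<rho> using that unfolding skew_2 by simp
    show "t \<le> p" using Xm by simp
    show "skew t x y (p, 2) = Some m" using p unfolding skew_2 by simp
    show "m < u" if u: "skew t x y (p + 1, 1) = Some u" for u
    proof -
      \<comment> \<open>The left cell in row \<open>p + 1\<close> has list index
        \<open>p - t\<close>, by \<open>Xm\<close> the number of entries of \<open>x\<close> up to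
        \<open>m\<close>. List indices start at 0, so this is the first entry beyond
        \<open>m\<close>.\<close>
      have *: "p - t < card x" "u = ?xs ! (p - t)"
        using u Xm unfolding skew_1 by (auto split: if_splits)
      then have "\<not> u \<le> m" using nth_sorted_list_of_set_le_iff[OF fin(1) *(1), of m] Xm by simp
      then show ?thesis by simp
    qed
    show "\<rho> = p" if "skew t x y (\<rho>, 2) = Some m" for \<rho>
    proof -
      have *: "1 \<le> \<rho>" "\<rho> \<le> card y" "?ys ! (\<rho> - 1) = m"
        using that unfolding skew_2 by (auto split: if_splits)
      then have "\<rho> - 1 < card y" by simp
      from card_le_nth_sorted_list_of_set[OF fin(2) this] *(3) Ym *(1) show ?thesis by simp
    qed
    show "\<exists>u v. skew t x y (q + 1, 1) = Some u \<and> skew t x y (q, 2) = Some v \<and> u \<le> v"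
      if q: "t \<le> q" "q < p" for q
    proof -
      have q1: "1 \<le> q" "q \<le> card y" "q - 1 < card y" using q \<open>0 < t\<close> p by auto
      let ?k = "?ys ! (q - 1)"
      have Yk: "card (y \<inter> {..?k}) = q"
        using card_le_nth_sorted_list_of_set[OF fin(2) q1(3)] q1(1) by simp
      have "\<not> m \<le> ?k"
      proof
        assume "m \<le> ?k"
        then have "card (y \<inter> {..m}) \<le> card (y \<inter> {..?k})" using fin by (intro card_mono) auto
        with Yk Ym q show False by simp
      qed
      \<comment> \<open>Strictness before the first maximum gains the one row needed: it bounds the
        left entry of row \<open>q + 1\<close>, not just that of row \<open>q\<close>, by
        \<open>?k\<close>.\<close>
      then have "height y x ?k < int t" using m'(2)[of ?k] ht by simp
      then have X: "q - t < card (x \<inter> {..?k})" using q unfolding h Yk by simp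
      then have "q - t < card x" using card_le[of ?k] by simp
      moreover from this have "?xs ! (q - t) \<le> ?k"
        using nth_sorted_list_of_set_le_iff[OF fin(1), of "q - t" ?k] X by simp
      moreover have "q + 1 - (t + 1) = q - t" by simp
      ultimately show ?thesis using q q1 unfolding skew_1 skew_2 by simp
    qed
  qed
  then show ?thesis unfolding column_skew[OF fin] .
qed

lemma star_e_dot_eq_J_op:
  assumes b: "b \<in> col_fam n l"
  shows "star (e_dot n j) b = J_op j b"
proof -
  note yx = col_fam_subset[OF b, of "j + 1"] col_fam_subset[OF b, of j]
  let ?t = "min_shift (b j) (b (j + 1))"
  show ?thesis
  proof (cases "star (e_dot n j) b")
    case None
    then have "?t = 0" using star_e_dot_eq_None_iff[OF b, of j] min_shift_eq[OF yx] by simp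
    with None show ?thesis by (simp add: J_op_def)
  next
    case (Some b')
    then obtain m where m: "first_max (height (b (j + 1)) (b j)) m"
      and b': "b' = b(j := insert m (b j), j + 1 := b (j + 1) - {m})"
      using star_e_dot_first_max[OF b] by blast
    have "?t \<noteq> 0"
    proof
      assume "?t = 0"
      then have "top_height n (b (j + 1)) (b j) = 0" using min_shift_eq[OF yx] by simp
      with Some show False using star_e_dot_eq_None_iff[OF b, of j] by simp
    qed
    then show ?thesis
      using column_jdt_skew[OF yx m refl] unfolding Some b' by (simp add: J_op_def Let_def)
  qed
qed

theorem theorem2p19:
  fixes n l s j :: nat and b :: cols
  assumes "n \<ge> 2" and "l \<ge> 2" and "j \<in> {1..l - 1}" and "b \<in> Fset n l s"
  shows "star (e_dot n j) b = J_op j b \<and> star (sigma_dot n j) b = Some (R_op n j b)"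
proof -
  have "b \<in> col_fam n l" using assms(4) Fset_subset_col_fam by blast
  then show ?thesis using star_e_dot_eq_J_op star_sigma_dot_eq_R_op assms(3) by blast
qed

end
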